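(* Let $(M,g)$ be a Kähler manifold of real dimension $n\ge4$ with Levi-Civita connection $\nabla$ and Ricci tensor $\mathrm{r}$, and let functions $\tau,\alpha,\sigma:M\to\mathbb{R}$ satisfy $$\alpha\nabla d\tau+\mathrm{r}=\sigma g,$$ where $\alpha$ is a $C^\infty$ function of $\tau$ and $\alpha\nabla d\tau\neq0$ on a dense subset of $M$. Let $U$ be an open submanifold of $M$ such that $\alpha\,d\alpha$ and $d\tau$ are nonzero at all points of $U$, and suppose that at least one of the following holds: (i) $n>4$; (ii) $n=4$ and $d\sigma\wedge d\tau=0$ identically in $U$; (iii) $dQ\wedge d\tau=0$ everywhere in $U$, where $Q=g(\nabla\tau,\nabla\tau)$. Then $\tau:U\to\mathbb{R}$ is a special Kähler-Ricci potential on the Kähler manifold $(U,g)$.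
   Context: All manifolds and metrics are of class $C^\infty$, and manifolds are connected. $\nabla d\tau$ is the Hessian of $\tau$. "$\alpha$ is a $C^\infty$ function of $\tau$" means that $\alpha$ is the composite of $\tau$ with a $C^\infty$ function of a real variable. A special Kähler-Ricci potential on a Kähler manifold $(N,g)$ with complex-structure tensor $J$ is any nonconstant function $\tau:N\to\mathbb{R}$ having a real-holomorphic gradient $v=\nabla\tau$ and such that, at points where $v\neq0$, all nonzero vectors orthogonal to $v$ and $Jv$ are eigenvectors of both $\nabla d\tau$ and the Ricci tensor $\mathrm{r}$ (these symmetric 2-tensors being identified, via $g$, with endomorphisms of the tangent bundle). *)

theory Defs
  imports "HOL-Analysis.Analysis"
begin

subsection \<open>Smooth functions on open sets\<close>

text \<open>Used for open sets \<open>S\<close> of finite-dimensional spaces only; there \<open>Ck_on k S f\<close> says that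
  \<open>f\<close> is of class $C^k$ on \<open>S\<close>.\<close>

primrec Ck_on :: "nat \<Rightarrow> 'a::real_normed_vector set \<Rightarrow> ('a \<Rightarrow> 'b::real_normed_vector) \<Rightarrow> bool" where
  "Ck_on 0 S f \<longleftrightarrow> continuous_on S f"
| "Ck_on (Suc k) S f \<longleftrightarrow> (\<forall>x\<in>S. f differentiable at x) \<and>
     (\<forall>u. Ck_on k S (\<lambda>x. frechet_derivative f (at x) u))"

definition smooth_on :: "'a::real_normed_vector set \<Rightarrow> ('a \<Rightarrow> 'b::real_normed_vector) \<Rightarrow> bool" where
  "smooth_on S f \<longleftrightarrow> (\<forall>k. Ck_on k S f)"


subsection \<open>Tensor calculus in coordinates\<close>

text \<open>Here \<open>g\<close> is the matrix-valued function \<open>(g\<^sub>i\<^sub>j)\<close> of components of a metric in one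
  coordinate system, and \<open>f\<close> a function expressed in the same coordinates.\<close>

definition pd :: "'n::finite \<Rightarrow> (real^'n \<Rightarrow> real) \<Rightarrow> real^'n \<Rightarrow> real" where
  "pd i f x = frechet_derivative f (at x) (axis i 1)"

definition differential :: "(real^'n::finite \<Rightarrow> real) \<Rightarrow> real^'n \<Rightarrow> real^'n" where
  "differential f x = (\<chi> i. pd i f x)"

definition wedge :: "real^'n \<Rightarrow> real^'n \<Rightarrow> real^'n^'n" where
  "wedge a b = (\<chi> i j. a $ i * b $ j - a $ j * b $ i)"

text \<open>\<open>christoffel g k i j\<close> is the component $\Gamma^k_{ij}$ of the Levi-Civita connection,
  $\nabla_{\partial_i}\partial_j = \sum_k \Gamma^k_{ij}\,\partial_k$.\<close>

definition christoffel :: "(real^'n \<Rightarrow> real^'n^'n) \<Rightarrow> 'n::finite \<Rightarrow> 'n \<Rightarrow> 'n \<Rightarrow> real^'n \<Rightarrow> real" where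
  "christoffel g k i j x = (\<Sum>l\<in>UNIV. matrix_inv (g x) $ k $ l *
     (pd i (\<lambda>y. g y $ j $ l) x + pd j (\<lambda>y. g y $ i $ l) x - pd l (\<lambda>y. g y $ i $ j) x)) / 2"

text \<open>\<open>riemann g l k i j\<close> is the $\partial_l$-component of
  $R(\partial_i,\partial_j)\partial_k =
    \nabla_{\partial_i}\nabla_{\partial_j}\partial_k - \nabla_{\partial_j}\nabla_{\partial_i}\partial_k$;
  the Ricci tensor is $r(Y,Z) = \mathrm{tr}\,(X \mapsto R(X,Y)Z)$, which is positive on round
  spheres.\<close>

definition riemann :: "(real^'n \<Rightarrow> real^'n^'n) \<Rightarrow> 'n::finite \<Rightarrow> 'n \<Rightarrow> 'n \<Rightarrow> 'n \<Rightarrow> real^'n \<Rightarrow> real" where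
  "riemann g l k i j x = pd i (christoffel g l j k) x - pd j (christoffel g l i k) x
     + (\<Sum>m\<in>UNIV. christoffel g l i m x * christoffel g m j k x
                  - christoffel g l j m x * christoffel g m i k x)"

definition ricci :: "(real^'n::finite \<Rightarrow> real^'n^'n) \<Rightarrow> real^'n \<Rightarrow> real^'n^'n" where
  "ricci g x = (\<chi> j k. \<Sum>i\<in>UNIV. riemann g i k i j x)"

definition hessian ::
  "(real^'n::finite \<Rightarrow> real^'n^'n) \<Rightarrow> (real^'n \<Rightarrow> real) \<Rightarrow> real^'n \<Rightarrow> real^'n^'n" where
  "hessian g f x = (\<chi> i j. pd i (pd j f) x - (\<Sum>k\<in>UNIV. christoffel g k i j x * pd k f x))"

definition gradient ::
  "(real^'n::finite \<Rightarrow> real^'n^'n) \<Rightarrow> (real^'n \<Rightarrow> real) \<Rightarrow> real^'n \<Rightarrow> real^'n" where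
  "gradient g f x = matrix_inv (g x) *v differential f x"

definition gradient_sq ::
  "(real^'n::finite \<Rightarrow> real^'n^'n) \<Rightarrow> (real^'n \<Rightarrow> real) \<Rightarrow> real^'n \<Rightarrow> real" where
  "gradient_sq g f x = gradient g f x \<bullet> (g x *v gradient g f x)"

text \<open>For a field \<open>J\<close> of endomorphisms, \<open>J x $ i $ j\<close> is the $\partial_i$-component of
  $J\partial_j$.  The value of \<open>cov_deriv_endo g J k\<close> is $\nabla_{\partial_k} J$ and that of
  \<open>lie_deriv_endo v J\<close> is the Lie derivative of \<open>J\<close> along the vector field \<open>v\<close>.\<close>

definition cov_deriv_endo ::
  "(real^'n::finite \<Rightarrow> real^'n^'n) \<Rightarrow> (real^'n \<Rightarrow> real^'n^'n) \<Rightarrow> 'n \<Rightarrow> real^'n \<Rightarrow> real^'n^'n" where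
  "cov_deriv_endo g J k x = (\<chi> i j. pd k (\<lambda>y. J y $ i $ j) x
     + (\<Sum>l\<in>UNIV. christoffel g i k l x * J x $ l $ j - christoffel g l k j x * J x $ i $ l))"

definition lie_deriv_endo ::
  "(real^'n::finite \<Rightarrow> real^'n) \<Rightarrow> (real^'n \<Rightarrow> real^'n^'n) \<Rightarrow> real^'n \<Rightarrow> real^'n^'n" where
  "lie_deriv_endo v J x = (\<chi> i j. \<Sum>k\<in>UNIV. v x $ k * pd k (\<lambda>y. J y $ i $ j) x
     - J x $ k $ j * pd k (\<lambda>y. v y $ i) x + J x $ i $ k * pd j (\<lambda>y. v y $ k) x)"


subsection \<open>Manifolds\<close>

text \<open>A chart is a pair of its domain and its coordinate map; the values of the map outside the
  domain are irrelevant.  A smooth structure is a maximal atlas.\<close>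

type_synonym ('a, 'n) chart = "'a set \<times> ('a \<Rightarrow> real^'n)"

abbreviation cdom :: "('a, 'n::finite) chart \<Rightarrow> 'a set" where
  "cdom c \<equiv> fst c"

abbreviation coord :: "('a, 'n::finite) chart \<Rightarrow> 'a \<Rightarrow> real^'n" where
  "coord c \<equiv> snd c"

abbreviation cimage :: "('a, 'n::finite) chart \<Rightarrow> (real^'n) set" where
  "cimage c \<equiv> coord c ` cdom c"

definition cinv :: "('a, 'n::finite) chart \<Rightarrow> real^'n \<Rightarrow> 'a" where
  "cinv c = inv_into (cdom c) (coord c)"

definition is_chart :: "'a topology \<Rightarrow> ('a, 'n::finite) chart \<Rightarrow> bool" where
  "is_chart X c \<longleftrightarrow> openin X (cdom c) \<and> open (cimage c) \<and>
     homeomorphic_map (subtopology X (cdom c)) (top_of_set (cimage c)) (coord c)"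

definition overlap :: "('a, 'n::finite) chart \<Rightarrow> ('a, 'n) chart \<Rightarrow> (real^'n) set" where
  "overlap c d = coord c ` (cdom c \<inter> cdom d)"

definition transition :: "('a, 'n::finite) chart \<Rightarrow> ('a, 'n) chart \<Rightarrow> real^'n \<Rightarrow> real^'n" where
  "transition c d = coord d \<circ> cinv c"

definition compatible :: "('a, 'n::finite) chart \<Rightarrow> ('a, 'n) chart \<Rightarrow> bool" where
  "compatible c d \<longleftrightarrow>
     smooth_on (overlap c d) (transition c d) \<and> smooth_on (overlap d c) (transition d c)"

definition smooth_structure :: "'a topology \<Rightarrow> ('a, 'n::finite) chart set \<Rightarrow> bool" where
  "smooth_structure X A \<longleftrightarrow>
     (\<forall>c\<in>A. is_chart X c) \<and> (\<Union>c\<in>A. cdom c) = topspace X \<and>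
     (\<forall>c\<in>A. \<forall>d\<in>A. compatible c d) \<and>
     (\<forall>c. is_chart X c \<and> (\<forall>d\<in>A. compatible c d) \<longrightarrow> c \<in> A)"

definition smooth_manifold :: "'a topology \<Rightarrow> ('a, 'n::finite) chart set \<Rightarrow> bool" where
  "smooth_manifold X A \<longleftrightarrow> topspace X \<noteq> {} \<and> Hausdorff_space X \<and> second_countable X \<and>
     connected_space X \<and> smooth_structure X A"


subsection \<open>Kaehler manifolds\<close>

text \<open>A tensor field on a manifold is given by its components: \<open>metric M c\<close> and \<open>cplx M c\<close> are the
  matrices of components, in the chart \<open>c\<close>, of the metric and of the complex-structure tensor, as
  functions of the coordinates.  Only the values for charts \<open>c\<close> of the atlas and at points of
  \<open>cimage c\<close> matter; for different charts they are related by the usual transformation laws.\<close>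

record ('a, 'n) kahler_data =
  mtop :: "'a topology"
  atlas :: "('a, 'n) chart set"
  metric :: "('a, 'n) chart \<Rightarrow> real^'n \<Rightarrow> real^'n^'n"
  cplx :: "('a, 'n) chart \<Rightarrow> real^'n \<Rightarrow> real^'n^'n"

definition riemannian_metric ::
  "('a, 'n::finite) chart set \<Rightarrow> (('a, 'n) chart \<Rightarrow> real^'n \<Rightarrow> real^'n^'n) \<Rightarrow> bool" where
  "riemannian_metric A g \<longleftrightarrow>
     (\<forall>c\<in>A. smooth_on (cimage c) (g c) \<and>
       (\<forall>x\<in>cimage c. transpose (g c x) = g c x \<and> (\<forall>u. u \<noteq> 0 \<longrightarrow> u \<bullet> (g c x *v u) > 0))) \<and>
     (\<forall>c\<in>A. \<forall>d\<in>A. \<forall>x\<in>overlap c d.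
       g c x = transpose (jacobian (transition c d) (at x)) ** g d (transition c d x)
                 ** jacobian (transition c d) (at x))"

definition endo_field ::
  "('a, 'n::finite) chart set \<Rightarrow> (('a, 'n) chart \<Rightarrow> real^'n \<Rightarrow> real^'n^'n) \<Rightarrow> bool" where
  "endo_field A J \<longleftrightarrow>
     (\<forall>c\<in>A. smooth_on (cimage c) (J c)) \<and>
     (\<forall>c\<in>A. \<forall>d\<in>A. \<forall>x\<in>overlap c d.
       jacobian (transition c d) (at x) ** J c x
         = J d (transition c d x) ** jacobian (transition c d) (at x))"

text \<open>Kaehler: \<open>J\<close> is an orthogonal almost complex structure that is parallel for the Levi-Civita
  connection (hence integrable).\<close>

definition kahler_manifold :: "('a, 'n::finite) kahler_data \<Rightarrow> bool" where
  "kahler_manifold M \<longleftrightarrow>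
     smooth_manifold (mtop M) (atlas M) \<and>
     riemannian_metric (atlas M) (metric M) \<and> endo_field (atlas M) (cplx M) \<and>
     (\<forall>c\<in>atlas M. \<forall>x\<in>cimage c.
        cplx M c x ** cplx M c x = - mat 1 \<and>
        transpose (cplx M c x) ** metric M c x ** cplx M c x = metric M c x \<and>
        (\<forall>k. cov_deriv_endo (metric M c) (cplx M c) k x = 0))"

definition open_submanifold :: "('a, 'n::finite) kahler_data \<Rightarrow> 'a set \<Rightarrow> ('a, 'n) kahler_data" where
  "open_submanifold M U =
     M\<lparr>mtop := subtopology (mtop M) U, atlas := {c \<in> atlas M. cdom c \<subseteq> U}\<rparr>"

definition charts_at :: "('a, 'n::finite) kahler_data \<Rightarrow> 'a \<Rightarrow> ('a, 'n) chart set" where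
  "charts_at M p = {c \<in> atlas M. p \<in> cdom c}"

definition local_rep :: "('a, 'n::finite) chart \<Rightarrow> ('a \<Rightarrow> real) \<Rightarrow> real^'n \<Rightarrow> real" where
  "local_rep c f = f \<circ> cinv c"

definition smooth_fun :: "('a, 'n::finite) kahler_data \<Rightarrow> ('a \<Rightarrow> real) \<Rightarrow> bool" where
  "smooth_fun M f \<longleftrightarrow> (\<forall>c\<in>atlas M. smooth_on (cimage c) (local_rep c f))"

text \<open>The function of a real variable need only be defined on some open set containing the range
  of \<open>t\<close>.\<close>

definition smooth_function_of ::
  "('a, 'n::finite) kahler_data \<Rightarrow> ('a \<Rightarrow> real) \<Rightarrow> ('a \<Rightarrow> real) \<Rightarrow> bool" where
  "smooth_function_of M a t \<longleftrightarrow>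
     (\<exists>(F :: real \<Rightarrow> real) I. open I \<and> smooth_on I F \<and>
        (\<forall>p\<in>topspace (mtop M). t p \<in> I \<and> a p = F (t p)))"

text \<open>Components at the point \<open>p\<close>, relative to the chart \<open>c\<close>.\<close>

definition metric_at :: "('a, 'n::finite) kahler_data \<Rightarrow> ('a, 'n) chart \<Rightarrow> 'a \<Rightarrow> real^'n^'n" where
  "metric_at M c p = metric M c (coord c p)"

definition cplx_at :: "('a, 'n::finite) kahler_data \<Rightarrow> ('a, 'n) chart \<Rightarrow> 'a \<Rightarrow> real^'n^'n" where
  "cplx_at M c p = cplx M c (coord c p)"

definition diff_at :: "('a \<Rightarrow> real) \<Rightarrow> ('a, 'n::finite) chart \<Rightarrow> 'a \<Rightarrow> real^'n" where
  "diff_at f c p = differential (local_rep c f) (coord c p)"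

definition hess_at ::
  "('a, 'n::finite) kahler_data \<Rightarrow> ('a \<Rightarrow> real) \<Rightarrow> ('a, 'n) chart \<Rightarrow> 'a \<Rightarrow> real^'n^'n" where
  "hess_at M f c p = hessian (metric M c) (local_rep c f) (coord c p)"

definition ricci_at :: "('a, 'n::finite) kahler_data \<Rightarrow> ('a, 'n) chart \<Rightarrow> 'a \<Rightarrow> real^'n^'n" where
  "ricci_at M c p = ricci (metric M c) (coord c p)"

definition grad_at ::
  "('a, 'n::finite) kahler_data \<Rightarrow> ('a \<Rightarrow> real) \<Rightarrow> ('a, 'n) chart \<Rightarrow> 'a \<Rightarrow> real^'n" where
  "grad_at M f c p = gradient (metric M c) (local_rep c f) (coord c p)"

text \<open>The differential of the function $Q = g(\nabla f,\nabla f)$.\<close>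

definition diff_gradsq_at ::
  "('a, 'n::finite) kahler_data \<Rightarrow> ('a \<Rightarrow> real) \<Rightarrow> ('a, 'n) chart \<Rightarrow> 'a \<Rightarrow> real^'n" where
  "diff_gradsq_at M f c p = differential (gradient_sq (metric M c) (local_rep c f)) (coord c p)"


subsection \<open>Special Kaehler-Ricci potentials\<close>

definition real_holomorphic_gradient :: "('a, 'n::finite) kahler_data \<Rightarrow> ('a \<Rightarrow> real) \<Rightarrow> bool" where
  "real_holomorphic_gradient M f \<longleftrightarrow>
     (\<forall>c\<in>atlas M. \<forall>x\<in>cimage c.
        lie_deriv_endo (gradient (metric M c) (local_rep c f)) (cplx M c) x = 0)"

definition is_eigenvector :: "real^'n^'n \<Rightarrow> real^'n::finite \<Rightarrow> bool" where
  "is_eigenvector A w \<longleftrightarrow> w \<noteq> 0 \<and> (\<exists>l. A *v w = l *\<^sub>R w)"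

text \<open>The endomorphism $A$ with $g(Aw,w') = b(w,w')$, for a metric \<open>g\<close> and a symmetric
  2-tensor \<open>b\<close>.\<close>

definition as_endo :: "real^'n::finite^'n \<Rightarrow> real^'n^'n \<Rightarrow> real^'n^'n" where
  "as_endo g b = matrix_inv g ** b"

definition special_kr_potential :: "('a, 'n::finite) kahler_data \<Rightarrow> ('a \<Rightarrow> real) \<Rightarrow> bool" where
  "special_kr_potential M t \<longleftrightarrow>
     kahler_manifold M \<and> smooth_fun M t \<and> \<not> t constant_on topspace (mtop M) \<and>
     real_holomorphic_gradient M t \<and>
     (\<forall>p\<in>topspace (mtop M). \<forall>c\<in>charts_at M p.
        let g = metric_at M c p; v = grad_at M t c p; Jv = cplx_at M c p *v v
        in v \<noteq> 0 \<longrightarrow>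
             (\<forall>w. w \<noteq> 0 \<and> w \<bullet> (g *v v) = 0 \<and> w \<bullet> (g *v Jv) = 0 \<longrightarrow>
                is_eigenvector (as_endo g (hess_at M t c p)) w \<and>
                is_eigenvector (as_endo g (ricci_at M c p)) w))"

end

theory Submission
  imports Defs
begin

text \<open>
  Since the Ricci tensor and the metric are \<open>J\<close>-invariant, so is the Hessian of \<open>\<tau>\<close> wherever
  \<open>\<alpha> \<noteq> 0\<close>, which means that \<open>v = \<nabla>\<tau>\<close> is real-holomorphic.  Composing the three terms of the
  equation with \<open>J\<close> turns it into an equation between closed 2-forms: the Kaehler form \<open>\<omega>\<close>, the
  Ricci form, which is a multiple of \<open>tr (J R)\<close> and hence closed by the second Bianchi identity,
  and the form \<open>\<beta>\<close> of the Hessian, which is half the differential of \<open>d\<tau> \<circ> J\<close>.  Taking the exterior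
  derivative gives \<open>d\<alpha> \<and> \<beta> = d\<sigma> \<and> \<omega>\<close>.

  In dimension greater than 4 this forces \<open>d\<sigma>\<close> to be a multiple of \<open>d\<tau>\<close>: evaluate it on
  \<open>X, Y, JY\<close> with \<open>X\<close> in the kernel of \<open>d\<tau>\<close> and \<open>Y\<close> orthogonal to \<open>v, Jv, X, JX\<close>.  As soon as
  \<open>d\<sigma>\<close> is a multiple of \<open>d\<tau>\<close>, the forms \<open>\<beta>\<close> and \<open>\<omega>\<close> are proportional on the kernel of \<open>d\<tau>\<close>, so
  every vector orthogonal to \<open>v\<close> and \<open>Jv\<close> is an eigenvector of the Hessian.  In dimension 4 with
  \<open>dQ \<and> d\<tau> = 0\<close> the vector \<open>v\<close> is an eigenvector because \<open>dQ\<close> is twice the Hessian applied to \<open>v\<close>,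
  and on the remaining complex line every \<open>J\<close>-invariant symmetric form is a multiple of the metric.
\<close>

subsection \<open>Calculus of smooth functions\<close>

text \<open>Openness lets the derivative at a point be computed from values inside \<open>S\<close>
  alone. The induction varies \<open>f\<close> and \<open>g\<close> because its step passes to their
  directional derivatives.\<close>

lemma Ck_on_cong:
  assumes "open S" "\<And>x. x \<in> S \<Longrightarrow> f x = g x" "Ck_on k S f"
  shows "Ck_on k S g"
  using assms(2,3)
proof (induction k arbitrary: f g)
  case 0
  then show ?case by (metis Ck_on.simps(1) continuous_on_cong)
next
  case (Suc k)
  have d: "(g has_derivative frechet_derivative f (at x)) (at x)" if "x \<in> S" for x
    using Suc.prems that assms(1)
    by (metis Ck_on.simps(2) frechet_derivative_works has_derivative_transform_within_open)
  then have "frechet_derivative g (at x) = frechet_derivative f (at x)" if "x \<in> S" for x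
    using that by (metis frechet_derivative_at)
  with d Suc show ?case
    by (metis (no_types, lifting) Ck_on.simps(2) differentiableI)
qed

lemma Ck_on_subset: "Ck_on k S f \<Longrightarrow> T \<subseteq> S \<Longrightarrow> Ck_on k T f"
  by (induction k arbitrary: f) (auto intro: continuous_on_subset)

lemma Ck_on_SucD: "Ck_on (Suc k) S f \<Longrightarrow> Ck_on k S f"
proof (induction k arbitrary: f)
  case 0
  then show ?case
    by (simp add: differentiable_at_withinI differentiable_imp_continuous_on differentiable_on_def)
next
  case (Suc k)
  then show ?case by (metis Ck_on.simps(2))
qed

lemma Ck_on_const: "Ck_on k S (\<lambda>x. c)"
  by (induction k arbitrary: c) simp_all

lemma Ck_on_add:
  assumes "open S"
  shows "Ck_on k S f \<Longrightarrow> Ck_on k S g \<Longrightarrow> Ck_on k S (\<lambda>x. f x + g x)"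
proof (induction k arbitrary: f g)
  case (Suc k)
  have "frechet_derivative (\<lambda>x. f x + g x) (at x) u
      = frechet_derivative f (at x) u + frechet_derivative g (at x) u" if "x \<in> S" for x u
    using Suc.prems that
    by (intro fun_cong[OF frechet_derivative_at[symmetric]] has_derivative_add)
      (auto simp: frechet_derivative_works)
  moreover have "Ck_on k S (\<lambda>x. frechet_derivative f (at x) u + frechet_derivative g (at x) u)" for u
    using Suc.prems by (intro Suc.IH) auto
  ultimately have "Ck_on k S (\<lambda>x. frechet_derivative (\<lambda>x. f x + g x) (at x) u)" for u
    by (smt (verit) Ck_on_cong assms)
  then show ?case using Suc.prems by auto
qed (auto intro: continuous_intros)

lemma Ck_on_bounded_linear:
  assumes "open S" "bounded_linear L"
  shows "Ck_on k S f \<Longrightarrow> Ck_on k S (\<lambda>x. L (f x))"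
proof (induction k arbitrary: f)
  case 0
  then show ?case using assms(2) by (simp add: bounded_linear.continuous_on)
next
  case (Suc k)
  have d: "((\<lambda>x. L (f x)) has_derivative (\<lambda>u. L (frechet_derivative f (at x) u))) (at x)"
    if "x \<in> S" for x
    using Suc.prems that
    by (intro bounded_linear.has_derivative[OF assms(2)]) (auto simp: frechet_derivative_works)
  then have "frechet_derivative (\<lambda>x. L (f x)) (at x) = (\<lambda>u. L (frechet_derivative f (at x) u))"
    if "x \<in> S" for x using that by (metis frechet_derivative_at)
  then have "Ck_on k S (\<lambda>x. frechet_derivative (\<lambda>x. L (f x)) (at x) u)" for u
    using Ck_on_cong[OF assms(1) _ Suc.IH] Suc.prems by (smt (verit) Ck_on.simps(2))
  then show ?case using d by (auto simp: differentiable_def)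
qed

lemma Ck_on_mult:
  fixes f g :: "'a::real_normed_vector \<Rightarrow> real"
  assumes "open S"
  shows "Ck_on k S f \<Longrightarrow> Ck_on k S g \<Longrightarrow> Ck_on k S (\<lambda>x. f x * g x)"
proof (induction k arbitrary: f g)
  case (Suc k)
  have "frechet_derivative (\<lambda>x. f x * g x) (at x) u
      = f x * frechet_derivative g (at x) u + frechet_derivative f (at x) u * g x"
    if "x \<in> S" for x u
    using Suc.prems that
    by (intro fun_cong[OF frechet_derivative_at[symmetric]] has_derivative_mult)
      (auto simp: frechet_derivative_works)
  moreover have "Ck_on k S (\<lambda>x. f x * frechet_derivative g (at x) u
      + frechet_derivative f (at x) u * g x)"
    for u using Suc by (intro Ck_on_add assms Suc.IH) (auto intro: Ck_on_SucD)
  ultimately have "Ck_on k S (\<lambda>x. frechet_derivative (\<lambda>x. f x * g x) (at x) u)" for u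
    by (smt (verit) Ck_on_cong assms)
  then show ?case using Suc.prems by auto
qed (auto intro: continuous_intros)

text \<open>The derivative of the reciprocal is a product of reciprocals with the derivative of
  \<open>f\<close>, so the induction hypothesis for the same \<open>f\<close> feeds the product
  rule.\<close>

lemma Ck_on_inverse:
  fixes f :: "'a::real_normed_vector \<Rightarrow> real"
  assumes "open S" and nz: "\<And>x. x \<in> S \<Longrightarrow> f x \<noteq> 0"
  shows "Ck_on k S f \<Longrightarrow> Ck_on k S (\<lambda>x. inverse (f x))"
proof (induction k)
  case 0
  then show ?case using nz by (auto intro: continuous_intros)
next
  case (Suc k)
  have d: "((\<lambda>x. inverse (f x)) has_derivative
      (\<lambda>u. - (inverse (f x) * frechet_derivative f (at x) u * inverse (f x)))) (at x)"
    if "x \<in> S" for x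
    using Suc.prems that nz
    by (intro Deriv.has_derivative_inverse) (auto simp: frechet_derivative_works)
  then have e: "frechet_derivative (\<lambda>x. inverse (f x)) (at x) u
      = (-1) * (inverse (f x) * frechet_derivative f (at x) u * inverse (f x))" if "x \<in> S" for x u
    using frechet_derivative_at[OF d[OF that]] by (metis mult_minus1)
  have "Ck_on k S (\<lambda>x. (-1) * (inverse (f x) * frechet_derivative f (at x) u * inverse (f x)))" for u
    using Suc Ck_on_SucD[OF Suc.prems] by (intro Ck_on_mult assms Ck_on_const) auto
  then have "Ck_on k S (\<lambda>x. frechet_derivative (\<lambda>x. inverse (f x)) (at x) u)" for u
    by (smt (verit) Ck_on_cong assms(1) e)
  then show ?case using d by (auto simp: differentiable_def)
qed

lemma smooth_on_cong:
  "open S \<Longrightarrow> (\<And>x. x \<in> S \<Longrightarrow> f x = g x) \<Longrightarrow> smooth_on S f \<Longrightarrow> smooth_on S g"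
  unfolding smooth_on_def using Ck_on_cong by blast

lemma smooth_on_subset: "smooth_on S f \<Longrightarrow> T \<subseteq> S \<Longrightarrow> smooth_on T f"
  unfolding smooth_on_def using Ck_on_subset by blast

lemma smooth_on_const: "smooth_on S (\<lambda>x. c)"
  unfolding smooth_on_def using Ck_on_const by blast

lemma smooth_on_add:
  "open S \<Longrightarrow> smooth_on S f \<Longrightarrow> smooth_on S g \<Longrightarrow> smooth_on S (\<lambda>x. f x + g x)"
  unfolding smooth_on_def using Ck_on_add by blast

lemma smooth_on_mult:
  fixes f g :: "'a::real_normed_vector \<Rightarrow> real"
  shows "open S \<Longrightarrow> smooth_on S f \<Longrightarrow> smooth_on S g \<Longrightarrow> smooth_on S (\<lambda>x. f x * g x)"
  unfolding smooth_on_def using Ck_on_mult by blast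

lemma smooth_on_diff:
  fixes f g :: "'a::real_normed_vector \<Rightarrow> real"
  assumes "open S" "smooth_on S f" "smooth_on S g"
  shows "smooth_on S (\<lambda>x. f x - g x)"
  using smooth_on_add[OF assms(1,2) smooth_on_mult[OF assms(1) smooth_on_const[of S "-1"] assms(3)]]
  by simp

lemma smooth_on_divide:
  fixes f g :: "'a::real_normed_vector \<Rightarrow> real"
  assumes "open S" "smooth_on S f" "smooth_on S g" "\<And>x. x \<in> S \<Longrightarrow> g x \<noteq> 0"
  shows "smooth_on S (\<lambda>x. f x / g x)"
  unfolding divide_inverse using assms
  by (intro smooth_on_mult) (auto simp: smooth_on_def Ck_on_inverse)

lemma smooth_on_sum:
  assumes "open S" "\<And>i. i \<in> A \<Longrightarrow> smooth_on S (f i)"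
  shows "smooth_on S (\<lambda>x. \<Sum>i\<in>A. f i x)"
  using assms(2)
  by (induction A rule: infinite_finite_induct) (auto intro: smooth_on_const smooth_on_add assms(1))

lemma smooth_on_prod:
  fixes f :: "'i \<Rightarrow> 'a::real_normed_vector \<Rightarrow> real"
  assumes "open S" "\<And>i. i \<in> A \<Longrightarrow> smooth_on S (f i)"
  shows "smooth_on S (\<lambda>x. \<Prod>i\<in>A. f i x)"
  using assms(2)
  by (induction A rule: infinite_finite_induct) (auto intro: smooth_on_const smooth_on_mult assms(1))

lemma smooth_on_nth:
  fixes f :: "'a::real_normed_vector \<Rightarrow> 'b::real_normed_vector^'m"
  shows "open S \<Longrightarrow> smooth_on S f \<Longrightarrow> smooth_on S (\<lambda>x. f x $ i)"
  unfolding smooth_on_def using Ck_on_bounded_linear[OF _ bounded_linear_vec_nth] by blast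

lemma smooth_on_differentiable: "smooth_on S f \<Longrightarrow> x \<in> S \<Longrightarrow> f differentiable at x"
  unfolding smooth_on_def by (meson Ck_on.simps(2))

lemma smooth_on_frechet: "smooth_on S f \<Longrightarrow> smooth_on S (\<lambda>x. frechet_derivative f (at x) u)"
  unfolding smooth_on_def by (metis Ck_on.simps(2))

lemma smooth_on_continuous: "smooth_on S f \<Longrightarrow> continuous_on S f"
  unfolding smooth_on_def by (meson Ck_on.simps(1))

lemma smooth_on_pd: "smooth_on S f \<Longrightarrow> smooth_on S (pd i f)"
  using smooth_on_frechet[of S f "axis i 1"] by (simp add: pd_def[abs_def])

section \<open>Smoothness of determinants and of inverse matrices\<close>

lemma smooth_on_det:
  fixes A :: "'a::real_normed_vector \<Rightarrow> real^'n^'n"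
  assumes "open S" "\<And>i j. smooth_on S (\<lambda>x. A x $ i $ j)"
  shows "smooth_on S (\<lambda>x. det (A x))"
  unfolding det_def
  by (intro smooth_on_sum smooth_on_mult smooth_on_prod smooth_on_const assms)

lemma matrix_inv_mult:
  fixes A :: "real^'n^'n"
  assumes "invertible A"
  shows "A ** matrix_inv A = mat 1" "matrix_inv A ** A = mat 1"
proof -
  from assms have "\<exists>B. A ** B = mat 1 \<and> B ** A = mat 1" by (simp add: invertible_def)
  then have "A ** matrix_inv A = mat 1 \<and> matrix_inv A ** A = mat 1"
    unfolding matrix_inv_def by (rule someI_ex)
  then show "A ** matrix_inv A = mat 1" "matrix_inv A ** A = mat 1" by auto
qed

text \<open>By Cramer's rule each entry of the inverse is a quotient of two determinants, which are
  polynomials in the smooth entries.\<close>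

lemma smooth_on_matrix_inv:
  fixes A :: "'a::real_normed_vector \<Rightarrow> real^'n^'n"
  assumes "open S" and sm: "\<And>i j. smooth_on S (\<lambda>x. A x $ i $ j)"
    and inv: "\<And>x. x \<in> S \<Longrightarrow> invertible (A x)"
  shows "smooth_on S (\<lambda>x. matrix_inv (A x) $ k $ l)"
proof -
  \<comment> \<open>This is \<open>A x\<close> with column \<open>k\<close> replaced by the basis
    vector with index \<open>l\<close>; its determinant is the Cramer numerator.\<close>
  let ?B = "\<lambda>x. \<chi> i j. if j = k then axis l 1 $ i else A x $ i $ j"
  have nz: "det (A x) \<noteq> 0" if "x \<in> S" for x
    using inv[OF that] by (simp add: invertible_det_nz)
  have eq: "matrix_inv (A x) $ k $ l = det (?B x) / det (A x)" if "x \<in> S" for x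
  proof -
    have "A x *v (matrix_inv (A x) *v axis l 1) = axis l 1"
      using matrix_inv_mult[OF inv[OF that]] by (simp add: matrix_vector_mul_assoc)
    then have "matrix_inv (A x) *v axis l 1
        = (\<chi> k. det (\<chi> i j. if j = k then axis l 1 $ i else A x $ i $ j) / det (A x))"
      using cramer[OF nz[OF that]] by blast
    then show ?thesis
      by (simp add: vec_eq_iff matrix_vector_mult_basis column_def)
  qed
  have e: "smooth_on S (\<lambda>x. ?B x $ i $ j)" for i j
    by (cases "j = k") (simp_all add: smooth_on_const sm)
  have "smooth_on S (\<lambda>x. det (?B x) / det (A x))"
    by (intro smooth_on_divide smooth_on_det assms(1) sm e nz)
  then show ?thesis
    by (rule smooth_on_cong[OF assms(1), rotated]) (simp add: eq)
qed

text \<open>The mean value theorem is applied twice: along \<open>u\<close> to the increment of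
  \<open>f\<close> in direction \<open>h *\<^sub>R w\<close>, then along \<open>w\<close> to the
  derivative of \<open>f\<close> in direction \<open>u\<close>. The hypothesis \<open>sub\<close>
  keeps the whole parallelogram inside \<open>S\<close>.\<close>

lemma second_difference_mvt:
  fixes f :: "'a::real_normed_vector \<Rightarrow> real"
  assumes S: "open S" "smooth_on S f" and h: "h > 0"
    and sub: "\<And>s t. 0 \<le> s \<Longrightarrow> s \<le> h \<Longrightarrow> 0 \<le> t \<Longrightarrow> t \<le> h \<Longrightarrow> x + s *\<^sub>R u + t *\<^sub>R w \<in> S"
  obtains s t where "0 < s" "s < h" "0 < t" "t < h"
    "f (x + h *\<^sub>R u + h *\<^sub>R w) - f (x + h *\<^sub>R u) - f (x + h *\<^sub>R w) + f x
      = h * h * frechet_derivative (\<lambda>y. frechet_derivative f (at y) u) (at (x + s *\<^sub>R u + t *\<^sub>R w)) w"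
proof -
  let ?D = "\<lambda>y. frechet_derivative f (at y)"
  have fd: "(f has_derivative ?D y) (at y)" if "y \<in> S" for y
    using smooth_on_differentiable[OF S(2) that] frechet_derivative_works by blast
  have gd: "((\<lambda>y. ?D y u) has_derivative frechet_derivative (\<lambda>y. ?D y u) (at y)) (at y)" if "y \<in> S" for y
    using smooth_on_differentiable[OF smooth_on_frechet[OF S(2)] that] frechet_derivative_works by blast
  have lin: "linear (?D y)" if "y \<in> S" for y
    using fd[OF that] has_derivative_linear by blast
  have lin2: "linear (frechet_derivative (\<lambda>y. ?D y u) (at y))" if "y \<in> S" for y
    using gd[OF that] has_derivative_linear by blast
  have d1: "((\<lambda>s. f (x + s *\<^sub>R u + c *\<^sub>R w)) has_real_derivative ?D (x + s *\<^sub>R u + c *\<^sub>R w) u) (at s)"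
    if "0 \<le> s" "s \<le> h" "0 \<le> c" "c \<le> h" for s c
  proof -
    have "((\<lambda>s. x + s *\<^sub>R u + c *\<^sub>R w) has_derivative (\<lambda>r. r *\<^sub>R u)) (at s)"
      by (auto intro!: derivative_eq_intros)
    from has_derivative_compose[OF this, of f, OF fd[OF sub[OF that]]]
    have "((\<lambda>s. f (x + s *\<^sub>R u + c *\<^sub>R w)) has_derivative
        (\<lambda>r. ?D (x + s *\<^sub>R u + c *\<^sub>R w) (r *\<^sub>R u))) (at s)" .
    then show ?thesis
      using linear_cmul[OF lin[OF sub[OF that]]]
      by (simp add: has_field_derivative_def mult_commute_abs)
  qed
  have d2: "((\<lambda>t. ?D (x + s *\<^sub>R u + t *\<^sub>R w) u) has_real_derivative
      frechet_derivative (\<lambda>y. ?D y u) (at (x + s *\<^sub>R u + t *\<^sub>R w)) w) (at t)"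
    if "0 \<le> s" "s \<le> h" "0 \<le> t" "t \<le> h" for s t
  proof -
    have "((\<lambda>t. x + s *\<^sub>R u + t *\<^sub>R w) has_derivative (\<lambda>r. r *\<^sub>R w)) (at t)"
      by (auto intro!: derivative_eq_intros)
    from has_derivative_compose[OF this, of "\<lambda>y. ?D y u", OF gd[OF sub[OF that]]]
    have "((\<lambda>t. ?D (x + s *\<^sub>R u + t *\<^sub>R w) u) has_derivative
        (\<lambda>r. frechet_derivative (\<lambda>y. ?D y u) (at (x + s *\<^sub>R u + t *\<^sub>R w)) (r *\<^sub>R w))) (at t)" .
    then show ?thesis
      using linear_cmul[OF lin2[OF sub[OF that]]]
      by (simp add: has_field_derivative_def mult_commute_abs)
  qed
  \<comment> \<open>The summand \<open>0 *\<^sub>R w\<close> is left in place so that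
    \<open>d1\<close> matches with \<open>c = 0\<close>.\<close>
  let ?\<phi> = "\<lambda>s. f (x + s *\<^sub>R u + h *\<^sub>R w) - f (x + s *\<^sub>R u + 0 *\<^sub>R w)"
  have "\<exists>s. 0 < s \<and> s < h \<and> ?\<phi> h - ?\<phi> 0
      = (h - 0) * (?D (x + s *\<^sub>R u + h *\<^sub>R w) u - ?D (x + s *\<^sub>R u + 0 *\<^sub>R w) u)"
    using h d1[of _ h] d1[of _ 0] by (intro MVT2) (auto simp del: scaleR_zero_left add_0_right
        intro!: DERIV_diff)
  then obtain s where s: "0 < s" "s < h"
    "?\<phi> h - ?\<phi> 0 = h * (?D (x + s *\<^sub>R u + h *\<^sub>R w) u - ?D (x + s *\<^sub>R u + 0 *\<^sub>R w) u)" by auto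
  have "\<exists>t. 0 < t \<and> t < h \<and> ?D (x + s *\<^sub>R u + h *\<^sub>R w) u - ?D (x + s *\<^sub>R u + 0 *\<^sub>R w) u
      = (h - 0) * frechet_derivative (\<lambda>y. ?D y u) (at (x + s *\<^sub>R u + t *\<^sub>R w)) w"
    using h s by (intro MVT2) (auto intro!: d2)
  then obtain t where "0 < t" "t < h" "?D (x + s *\<^sub>R u + h *\<^sub>R w) u - ?D (x + s *\<^sub>R u + 0 *\<^sub>R w) u
      = h * frechet_derivative (\<lambda>y. ?D y u) (at (x + s *\<^sub>R u + t *\<^sub>R w)) w" by auto
  then show ?thesis using s that[of s t] by (simp add: algebra_simps)
qed

text \<open>The second difference over a parallelogram is symmetric in \<open>u\<close> and
  \<open>w\<close>, and each mixed derivative reproduces it at some nearby point. Continuity of both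
  mixed derivatives then forbids different values at \<open>x\<close>.\<close>

lemma frechet_derivative_commute:
  fixes f :: "'a::real_normed_vector \<Rightarrow> real"
  assumes S: "open S" "smooth_on S f" "x \<in> S"
  shows "frechet_derivative (\<lambda>y. frechet_derivative f (at y) u) (at x) w
       = frechet_derivative (\<lambda>y. frechet_derivative f (at y) w) (at x) u"
proof (rule ccontr)
  let ?F = "\<lambda>u w y. frechet_derivative (\<lambda>y. frechet_derivative f (at y) u) (at y) w"
  assume ne: "?F u w x \<noteq> ?F w u x"
  \<comment> \<open>Half the gap: a common value cannot be closer than \<open>e\<close> to both
    mixed derivatives at \<open>x\<close>.\<close>
  define e where "e = \<bar>?F u w x - ?F w u x\<bar> / 2"
  have "e > 0" using ne by (simp add: e_def)
  have cont: "continuous (at x) (?F u w)" for u w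
    using smooth_on_continuous[OF smooth_on_frechet[OF smooth_on_frechet[OF S(2)]]] S
    by (simp add: continuous_on_eq_continuous_at)
  obtain d1 where d1: "d1 > 0" "\<And>y. dist y x < d1 \<Longrightarrow> dist (?F u w y) (?F u w x) < e"
    using cont[of u w] \<open>e > 0\<close> unfolding continuous_at_eps_delta by metis
  obtain d2 where d2: "d2 > 0" "\<And>y. dist y x < d2 \<Longrightarrow> dist (?F w u y) (?F w u x) < e"
    using cont[of w u] \<open>e > 0\<close> unfolding continuous_at_eps_delta by metis
  obtain d3 where d3: "d3 > 0" "\<And>y. dist y x < d3 \<Longrightarrow> y \<in> S"
    using S unfolding open_dist by metis
  define d where "d = Min {d1, d2, d3}"
  have d: "d > 0" "d \<le> d1" "d \<le> d2" "d \<le> d3" using d1 d2 d3 by (auto simp: d_def)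
  \<comment> \<open>The summand 1 keeps \<open>N\<close> positive even if \<open>u\<close> and
    \<open>w\<close> vanish; then \<open>h * N = d / 2\<close> bounds the size of the
    parallelogram.\<close>
  define N where "N = 1 + norm u + norm w"
  define h where "h = d / N / 2"
  have pos: "N > 0" unfolding N_def by (smt (verit) norm_ge_zero)
  have h: "h > 0" using d pos by (simp add: h_def)
  have small: "dist (x + s *\<^sub>R u + t *\<^sub>R w) x < d" if "0 \<le> s" "s \<le> h" "0 \<le> t" "t \<le> h" for s t
  proof -
    have "norm (s *\<^sub>R u + t *\<^sub>R w) \<le> h * norm u + h * norm w"
      using that by (intro norm_triangle_le add_mono) (auto intro: mult_right_mono)
    also have "\<dots> \<le> h * N" using h by (simp add: N_def algebra_simps)
    also have "\<dots> = d / 2" using pos by (simp add: h_def)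
    finally show ?thesis using d by (simp add: dist_norm add.assoc)
  qed
  have sub: "x + s *\<^sub>R u + t *\<^sub>R w \<in> S" if "0 \<le> s" "s \<le> h" "0 \<le> t" "t \<le> h" for s t
    using small[OF that] d d3 by force
  have sub': "x + s *\<^sub>R w + t *\<^sub>R u \<in> S" if "0 \<le> s" "s \<le> h" "0 \<le> t" "t \<le> h" for s t
    using sub[OF that(3,4,1,2)] by (simp add: algebra_simps)
  obtain s t where st: "0 < s" "s < h" "0 < t" "t < h"
    "f (x + h *\<^sub>R u + h *\<^sub>R w) - f (x + h *\<^sub>R u) - f (x + h *\<^sub>R w) + f x
      = h * h * ?F u w (x + s *\<^sub>R u + t *\<^sub>R w)"
    using second_difference_mvt[OF S(1,2) h, of x u w] sub by metis
  obtain s' t' where st': "0 < s'" "s' < h" "0 < t'" "t' < h"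
    "f (x + h *\<^sub>R w + h *\<^sub>R u) - f (x + h *\<^sub>R w) - f (x + h *\<^sub>R u) + f x
      = h * h * ?F w u (x + s' *\<^sub>R w + t' *\<^sub>R u)"
    using second_difference_mvt[OF S(1,2) h, of x w u] sub' by metis
  have "f (x + h *\<^sub>R w + h *\<^sub>R u) = f (x + h *\<^sub>R u + h *\<^sub>R w)" by (simp add: algebra_simps)
  then have "h * h * ?F u w (x + s *\<^sub>R u + t *\<^sub>R w) = h * h * ?F w u (x + s' *\<^sub>R w + t' *\<^sub>R u)"
    using st(5) st'(5) by linarith
  then have "?F u w (x + s *\<^sub>R u + t *\<^sub>R w) = ?F w u (x + t' *\<^sub>R u + s' *\<^sub>R w)"
    using h by (simp add: algebra_simps)
  moreover have "dist (?F u w (x + s *\<^sub>R u + t *\<^sub>R w)) (?F u w x) < e"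
    using st d small[of s t] by (intro d1) auto
  moreover have "dist (?F w u (x + t' *\<^sub>R u + s' *\<^sub>R w)) (?F w u x) < e"
    using st' d small[of t' s'] by (intro d2) auto
  ultimately show False by (simp add: e_def dist_real_def abs_if split: if_splits)
qed

section \<open>Rules for partial derivatives\<close>

lemma pd_commute:
  "open S \<Longrightarrow> smooth_on S f \<Longrightarrow> x \<in> S \<Longrightarrow> pd i (pd j f) x = pd j (pd i f) x"
  unfolding pd_def[abs_def] by (rule frechet_derivative_commute)

text \<open>\<open>frechet_derivative\<close> chooses among the linear maps that are derivatives at
  \<open>x\<close>. Functions that agree near \<open>x\<close> have the same candidates, hence the
  same choice, differentiable or not.\<close>

lemma pd_cong:
  assumes "open S" "x \<in> S" "\<And>y. y \<in> S \<Longrightarrow> f y = g y"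
  shows "pd i f x = pd i g x"
proof -
  have "((f has_derivative D) (at x)) = ((g has_derivative D) (at x))" for D
    using assms by (metis has_derivative_transform_within_open)
  then show ?thesis by (simp add: pd_def frechet_derivative_def)
qed

lemma pd_add:
  "f differentiable at x \<Longrightarrow> g differentiable at x \<Longrightarrow> pd i (\<lambda>y. f y + g y) x = pd i f x + pd i g x"
  unfolding pd_def
  by (rule fun_cong[OF frechet_derivative_at[symmetric]], rule has_derivative_add)
    (auto simp: frechet_derivative_works)

lemma pd_diff:
  "f differentiable at x \<Longrightarrow> g differentiable at x \<Longrightarrow> pd i (\<lambda>y. f y - g y) x = pd i f x - pd i g x"
  unfolding pd_def
  by (rule fun_cong[OF frechet_derivative_at[symmetric]], rule has_derivative_diff)
    (auto simp: frechet_derivative_works)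

lemma pd_mult:
  "f differentiable at x \<Longrightarrow> g differentiable at x \<Longrightarrow>
    pd i (\<lambda>y. f y * g y) x = pd i f x * g x + f x * pd i g x"
  unfolding pd_def
  by (subst frechet_derivative_at[symmetric], rule has_derivative_mult)
    (auto simp: frechet_derivative_works)

lemma pd_const: "pd i (\<lambda>y. c) x = 0"
  by (simp add: pd_def)

lemma pd_sum:
  assumes "\<And>j. j \<in> A \<Longrightarrow> f j differentiable at x"
  shows "pd i (\<lambda>y. \<Sum>j\<in>A. f j y) x = (\<Sum>j\<in>A. pd i (f j) x)"
  unfolding pd_def using assms
  by (intro fun_cong[OF frechet_derivative_at[symmetric]] has_derivative_sum)
    (auto simp: frechet_derivative_works)

subsection \<open>Matrix identities\<close>

lemma matrix_add_rdistrib: "(A + B) ** C = A ** C + B ** (C :: real^'n^'m)"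
  by (simp add: vec_eq_iff matrix_matrix_mult_def sum.distrib distrib_right)

lemma matrix_diff_ldistrib: "A ** (B - C) = A ** B - A ** (C :: real^'n^'m)"
  by (simp add: vec_eq_iff matrix_matrix_mult_def sum_subtractf right_diff_distrib)

lemma matrix_diff_rdistrib: "(A - B) ** C = A ** C - B ** (C :: real^'n^'m)"
  by (simp add: vec_eq_iff matrix_matrix_mult_def sum_subtractf left_diff_distrib)

lemma matrix_minus_left: "(- A) ** B = - (A ** (B :: real^'n^'m))"
  by (simp add: vec_eq_iff matrix_matrix_mult_def sum_negf)

lemma matrix_minus_right: "A ** (- B) = - (A ** (B :: real^'n^'m))"
  by (simp add: vec_eq_iff matrix_matrix_mult_def sum_negf)

lemma transpose_add: "transpose (A + B) = transpose A + transpose B"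
  by (simp add: vec_eq_iff transpose_def)

lemma transpose_diff: "transpose (A - B) = transpose A - transpose B"
  by (simp add: vec_eq_iff transpose_def)

lemmas matrix_ring_simps = matrix_add_ldistrib matrix_add_rdistrib matrix_diff_ldistrib
  matrix_diff_rdistrib matrix_minus_left matrix_minus_right matrix_mul_assoc
  transpose_add transpose_diff matrix_transpose_mul

lemma matrix_mult_sum_right: "A ** (\<Sum>i\<in>I. f i) = (\<Sum>i\<in>I. A ** f i)" for A :: "real^'n^'m"
  by (induction I rule: infinite_finite_induct) (simp_all add: matrix_add_ldistrib)

lemma matrix_mult_sum_left: "(\<Sum>i\<in>I. f i) ** A = (\<Sum>i\<in>I. f i ** A)" for A :: "real^'n^'m"
  by (induction I rule: infinite_finite_induct) (simp_all add: matrix_add_rdistrib)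

lemma matrix_vector_minus_left: "(- A) *v x = - (A *v x)" for A :: "real^'n^'m"
  by (simp add: vec_eq_iff matrix_vector_mult_def sum_negf)

lemma matrix_vector_minus_right: "A *v (- x) = - (A *v x)" for A :: "real^'n^'m"
  by (simp add: vec_eq_iff matrix_vector_mult_def sum_negf)

lemma transpose_sum: "transpose (\<Sum>i\<in>I. f i) = (\<Sum>i\<in>I. transpose (f i))"
  by (simp add: vec_eq_iff transpose_def)

lemma matrix_mult_scaleR: "A ** (c *\<^sub>R B) = c *\<^sub>R (A ** B)" "(c *\<^sub>R A) ** B = c *\<^sub>R (A ** B)"
  for A B :: "real^'n^'n"
  by (simp_all add: vec_eq_iff matrix_matrix_mult_def sum_distrib_left mult_ac)

lemma transpose_scaleR: "transpose (c *\<^sub>R A) = c *\<^sub>R transpose A"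
  by (simp add: vec_eq_iff transpose_def)

lemma dot_matrix_transpose: "(A *v x) \<bullet> y = x \<bullet> (transpose A *v (y :: real^'m))"
  by (metis dot_lmul_matrix inner_commute transpose_matrix_vector)

lemma trace_matrix: "trace (matrix f) = (\<Sum>i\<in>UNIV. f (axis i 1) $ i)"
  by (simp add: trace_def matrix_def)

text \<open>Cyclicity of the trace for a linear map given as a function; it will carry
  \<open>J\<close> from the value of a curvature operator to its argument.\<close>

lemma trace_matrix_comp:
  fixes f :: "real^'n \<Rightarrow> real^'n"
  assumes "linear f"
  shows "trace (matrix (\<lambda>x. A *v f x)) = trace (matrix (\<lambda>x. f (A *v x)))"
proof -
  have "trace (matrix ((*v) A \<circ> f)) = trace (A ** matrix f)"
    using assms by (subst matrix_compose) auto
  also have "\<dots> = trace (matrix f ** A)" by (rule trace_mul_sym)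
  also have "\<dots> = trace (matrix (f \<circ> (*v) A))"
    using assms by (subst matrix_compose) auto
  finally show ?thesis by (simp add: o_def)
qed

lemma pos_def_invertible:
  fixes A :: "real^'n^'n"
  assumes "\<And>u. u \<noteq> 0 \<Longrightarrow> u \<bullet> (A *v u) > 0"
  shows "invertible A"
proof -
  have "\<forall>x. A *v x = 0 \<longrightarrow> x = 0" using assms by (metis inner_zero_right less_irrefl)
  then show ?thesis by (metis matrix_left_invertible_ker invertible_left_inverse)
qed

lemma matrix_eq_dot:
  fixes A B :: "real^'n^'m"
  assumes "\<And>x y. x \<bullet> (A *v y) = x \<bullet> (B *v y)"
  shows "A = B"
  using assms by (metis matrix_eq vector_eq_ldot)

declare transpose_matrix_vector [simp del]

subsection \<open>Hermitian linear algebra\<close>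

text \<open>If \<open>a\<close> were in the span of the others, it would lie in the subspace of
  vectors \<open>z\<close> with \<open>z \<bullet> (g *v a) = 0\<close>, which contains all the
  others but not \<open>a\<close>.\<close>

lemma independent_if_orthogonal:
  fixes g :: "real^'n^'n"
  assumes pos: "\<And>x. x \<in> B \<Longrightarrow> x \<bullet> (g *v x) \<noteq> 0"
    and orth: "\<And>x y. x \<in> B \<Longrightarrow> y \<in> B \<Longrightarrow> x \<noteq> y \<Longrightarrow> x \<bullet> (g *v y) = 0"
  shows "independent B"
proof
  assume "dependent B"
  then obtain a where a: "a \<in> B" "a \<in> span (B - {a})" unfolding dependent_def by blast
  have "subspace {z. z \<bullet> (g *v a) = 0}"
    by (rule subspaceI) (auto simp: inner_add_left)
  moreover have "B - {a} \<subseteq> {z. z \<bullet> (g *v a) = 0}" using orth a(1) by blast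
  ultimately have "span (B - {a}) \<subseteq> {z. z \<bullet> (g *v a) = 0}" by (rule span_minimal[rotated])
  then show False using a pos by blast
qed

text \<open>For an antisymmetric \<open>B\<close> these are the components of the 3-form obtained by
  wedging the 1-form \<open>a\<close> with the 2-form \<open>B\<close>, without a normalising
  factor.\<close>

definition wedge12 :: "real^'n \<Rightarrow> real^'n^'n \<Rightarrow> 'n \<Rightarrow> 'n \<Rightarrow> 'n \<Rightarrow> real" where
  "wedge12 a B k i j = a $ k * B $ i $ j + a $ i * B $ j $ k + a $ j * B $ k $ i"

lemma parallel_if_wedge_zero:
  fixes a b :: "real^'n"
  assumes "wedge a b = 0" "b \<noteq> 0"
  shows "\<exists>\<mu>. a = \<mu> *\<^sub>R b"
proof -
  obtain i where i: "b $ i \<noteq> 0" using assms(2) by (metis vec_eq_iff zero_index)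
  have "a $ j * b $ i = a $ i * b $ j" for j
    using arg_cong[OF assms(1), of "\<lambda>M. M $ j $ i"] by (simp add: wedge_def)
  then have "a = (a $ i / b $ i) *\<^sub>R b" using i by (simp add: vec_eq_iff field_simps)
  then show ?thesis by blast
qed

text \<open>A single tangent space in coordinates. Matrices such as \<open>g\<close> and
  \<open>h\<close> stand for bilinear forms, whereas \<open>J\<close> is an endomorphism.\<close>

locale hermitian_space =
  fixes g J :: "real^'n^'n"
  assumes g_sym: "transpose g = g"
    and g_pos: "u \<noteq> 0 \<Longrightarrow> u \<bullet> (g *v u) > 0"
    and J_sq: "J ** J = - mat 1"
    and J_orth: "transpose J ** g ** J = g"
begin

lemma g_commute: "X \<bullet> (g *v Y) = Y \<bullet> (g *v X)"
  by (metis dot_matrix_transpose g_sym inner_commute)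

lemma J_J: "J *v (J *v X) = - X"
  by (simp add: matrix_vector_mul_assoc J_sq matrix_vector_minus_left)

lemma J_invariant_form:
  "transpose J ** B ** J = B \<Longrightarrow> (J *v X) \<bullet> (B *v (J *v Y)) = X \<bullet> (B *v Y)"
  by (simp add: dot_matrix_transpose matrix_vector_mul_assoc matrix_mul_assoc)

lemma J_skew_form: "transpose J ** B ** J = B \<Longrightarrow> (J *v X) \<bullet> (B *v Y) = - (X \<bullet> (B *v (J *v Y)))"
  using J_invariant_form[of B X "J *v Y"] by (simp add: J_J matrix_vector_minus_right)

lemmas g_JJ = J_invariant_form[OF J_orth] and g_J = J_skew_form[OF J_orth]

lemma g_self_J: "X \<bullet> (g *v (J *v X)) = 0" "(J *v X) \<bullet> (g *v X) = 0"
  using g_J[of X X] g_commute[of X "J *v X"] by simp_all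

lemma J_nonzero: "X \<noteq> 0 \<Longrightarrow> J *v X \<noteq> 0"
  using J_J[of X] by auto

text \<open>Passes from components to values on arbitrary vectors: both sides are multilinear, so
  the component identities are summed against the coordinates of \<open>X\<close>, \<open>Y\<close>,
  \<open>Z\<close>.\<close>

lemma wedge12_contract:
  fixes a b X Y Z :: "real^'n"
  assumes "\<And>k i j. wedge12 a A k i j = wedge12 b B k i j"
  shows "(a \<bullet> X) * (Y \<bullet> (A *v Z)) + (a \<bullet> Y) * (Z \<bullet> (A *v X)) + (a \<bullet> Z) * (X \<bullet> (A *v Y))
       = (b \<bullet> X) * (Y \<bullet> (B *v Z)) + (b \<bullet> Y) * (Z \<bullet> (B *v X)) + (b \<bullet> Z) * (X \<bullet> (B *v Y))"
proof -
  have e: "(a \<bullet> X) * (Y \<bullet> (A *v Z)) + (a \<bullet> Y) * (Z \<bullet> (A *v X)) + (a \<bullet> Z) * (X \<bullet> (A *v Y))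
    = (\<Sum>k\<in>UNIV. \<Sum>i\<in>UNIV. \<Sum>j\<in>UNIV. X $ k * Y $ i * Z $ j * wedge12 a A k i j)"
    for a :: "real^'n" and A :: "real^'n^'n"
  proof -
    have 1: "(a \<bullet> X) * (Y \<bullet> (A *v Z))
        = (\<Sum>k\<in>UNIV. \<Sum>i\<in>UNIV. \<Sum>j\<in>UNIV. X $ k * Y $ i * Z $ j * (a $ k * A $ i $ j))"
      for a X Y Z :: "real^'n" and A :: "real^'n^'n"
    proof -
      have "(a \<bullet> X) * (Y \<bullet> (A *v Z)) = (\<Sum>k\<in>UNIV. a $ k * X $ k * (Y \<bullet> (A *v Z)))"
        by (simp add: inner_vec_def[of a X] sum_distrib_right)
      also have "\<dots> = (\<Sum>k\<in>UNIV. \<Sum>i\<in>UNIV. \<Sum>j\<in>UNIV. X $ k * Y $ i * Z $ j * (a $ k * A $ i $ j))"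
        by (simp add: inner_vec_def[of Y] matrix_vector_mult_def sum_distrib_left mult_ac)
      finally show ?thesis .
    qed
    \<comment> \<open>The cyclic terms come with their summation indices in another order; swapping
      the sums aligns them.\<close>
    have "(a \<bullet> Y) * (Z \<bullet> (A *v X))
        = (\<Sum>i\<in>UNIV. \<Sum>j\<in>UNIV. \<Sum>k\<in>UNIV. X $ k * Y $ i * Z $ j * (a $ i * A $ j $ k))"
      by (simp add: 1 mult_ac)
    also have "\<dots> = (\<Sum>i\<in>UNIV. \<Sum>k\<in>UNIV. \<Sum>j\<in>UNIV. X $ k * Y $ i * Z $ j * (a $ i * A $ j $ k))"
      by (rule sum.cong[OF refl], rule sum.swap)
    also have "\<dots> = (\<Sum>k\<in>UNIV. \<Sum>i\<in>UNIV. \<Sum>j\<in>UNIV. X $ k * Y $ i * Z $ j * (a $ i * A $ j $ k))"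
      by (rule sum.swap)
    finally have 2: "(a \<bullet> Y) * (Z \<bullet> (A *v X)) = \<dots>" .
    have "(a \<bullet> Z) * (X \<bullet> (A *v Y))
        = (\<Sum>j\<in>UNIV. \<Sum>k\<in>UNIV. \<Sum>i\<in>UNIV. X $ k * Y $ i * Z $ j * (a $ j * A $ k $ i))"
      by (simp add: 1 mult_ac)
    also have "\<dots> = (\<Sum>k\<in>UNIV. \<Sum>j\<in>UNIV. \<Sum>i\<in>UNIV. X $ k * Y $ i * Z $ j * (a $ j * A $ k $ i))"
      by (rule sum.swap)
    also have "\<dots> = (\<Sum>k\<in>UNIV. \<Sum>i\<in>UNIV. \<Sum>j\<in>UNIV. X $ k * Y $ i * Z $ j * (a $ j * A $ k $ i))"
      by (rule sum.cong[OF refl], rule sum.swap)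
    finally have 3: "(a \<bullet> Z) * (X \<bullet> (A *v Y)) = \<dots>" .
    show ?thesis
      unfolding 2 3 unfolding 1 wedge12_def sum.distrib[symmetric] distrib_left[symmetric] ..
  qed
  show ?thesis unfolding e assms ..
qed

text \<open>Here \<open>a\<close>, \<open>s\<close>, \<open>t\<close> play the roles of d\<alpha>,
  d\<sigma>, d\<tau>. For \<open>X\<close> in the kernel of \<open>t\<close> and a suitable
  \<open>Y\<close>, evaluation on \<open>X\<close>, \<open>Y\<close>, \<open>J *v Y\<close>
  annihilates the left side and leaves on the right only \<open>s \<bullet> X\<close> times minus
  the squared length of \<open>Y\<close>. Hence \<open>s\<close> vanishes on the kernel of
  \<open>t\<close>.\<close>

lemma parallel_if_wedge12:
  fixes a s t v :: "real^'n"
  assumes n: "CARD('n) > 4" and t: "g *v v = t" "t \<noteq> 0" and a: "a = c *\<^sub>R t"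
    and eq: "\<And>k i j. wedge12 a (h ** J) k i j = wedge12 s (g ** J) k i j"
  shows "\<exists>\<mu>. s = \<mu> *\<^sub>R t"
proof -
  have ker: "s \<bullet> X = 0" if X: "t \<bullet> X = 0" for X
  proof -
    \<comment> \<open>Euclidean orthogonality to these covectors is \<open>g\<close>-orthogonality
      to \<open>v\<close>, \<open>J *v v\<close>, \<open>X\<close>, \<open>J *v X\<close>. Four
      covectors cannot span a space of dimension above 4.\<close>
    let ?V = "{g *v v, g *v (J *v v), g *v X, g *v (J *v X)}"
    have "dim ?V \<le> card ?V" by (rule dim_le_card') simp
    also have "\<dots> \<le> 4" by (simp add: card_insert_if)
    finally have "dim ?V < DIM(real^'n)" using n by simp
    then obtain Y where Y: "Y \<noteq> 0" "\<And>y. y \<in> span ?V \<Longrightarrow> orthogonal Y y"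
      by (rule orthogonal_to_subspace_exists) blast
    have o: "Y \<bullet> (g *v v) = 0" "Y \<bullet> (g *v (J *v v)) = 0" "Y \<bullet> (g *v X) = 0" "Y \<bullet> (g *v (J *v X)) = 0"
      using Y(2) unfolding orthogonal_def by (auto intro: span_base)
    have "t \<bullet> Y = 0" "t \<bullet> (J *v Y) = 0"
      using o g_J[of Y v] by (simp_all add: t(1)[symmetric] inner_commute)
    moreover have "X \<bullet> (g *v (J *v Y)) = 0" using o g_J[of X Y] g_commute[of Y "J *v X"] by simp
    moreover have "(J *v Y) \<bullet> (g *v (J *v X)) = 0" using o by (simp add: g_JJ)
    ultimately have "(s \<bullet> X) * (Y \<bullet> (g *v (J *v (J *v Y)))) = 0"
      using wedge12_contract[OF eq, of X Y "J *v Y"] X a by (simp add: matrix_vector_mul_assoc[symmetric])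
    then show ?thesis using g_pos[OF Y(1)] by (simp add: J_J matrix_vector_minus_right)
  qed
  have tv: "t \<bullet> v \<noteq> 0" using t g_pos[of v] by (metis inner_commute less_irrefl matrix_vector_mult_0_right)
  \<comment> \<open>The factor is forced by evaluating at \<open>v\<close>; every \<open>Z\<close>
    is a multiple of \<open>v\<close> plus a vector in the kernel of \<open>t\<close>.\<close>
  have "s = ((s \<bullet> v) / (t \<bullet> v)) *\<^sub>R t"
  proof (rule vector_eq_rdot[THEN iffD1], rule allI)
    fix Z
    have "t \<bullet> (Z - ((t \<bullet> Z) / (t \<bullet> v)) *\<^sub>R v) = 0" using tv by (simp add: inner_diff_right)
    from ker[OF this] show "s \<bullet> Z = (((s \<bullet> v) / (t \<bullet> v)) *\<^sub>R t) \<bullet> Z"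
      by (simp add: inner_diff_right mult.commute)
  qed
  then show ?thesis by blast
qed

text \<open>Evaluating on \<open>X\<close>, \<open>Y\<close>, \<open>v\<close> with \<open>X\<close>
  and \<open>Y\<close> in the kernel of \<open>t\<close> leaves only the terms where the 1-form
  meets \<open>v\<close>. Cancelling \<open>t \<bullet> v\<close> makes the two 2-forms proportional
  on that kernel, with ratio \<open>\<mu> / c\<close>.\<close>

lemma eigenvector_if_wedge12:
  fixes a s t v :: "real^'n"
  assumes t: "g *v v = t" "t \<noteq> 0" and a: "a = c *\<^sub>R t" "c \<noteq> 0" and s: "s = \<mu> *\<^sub>R t"
    and h: "transpose J ** h ** J = h"
    and eq: "\<And>k i j. wedge12 a (h ** J) k i j = wedge12 s (g ** J) k i j"
    and w: "w \<bullet> (g *v v) = 0" "w \<bullet> (g *v (J *v v)) = 0"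
  shows "h *v w = (\<mu> / c) *\<^sub>R (g *v w)"
proof -
  have tv: "t \<bullet> v \<noteq> 0" using t g_pos[of v] by (metis inner_commute less_irrefl matrix_vector_mult_0_right)
  have "X \<bullet> (h *v (J *v Y)) = (\<mu> / c) * (X \<bullet> (g *v (J *v Y)))" if "t \<bullet> X = 0" "t \<bullet> Y = 0" for X Y
  proof -
    have "c * (t \<bullet> v) * (X \<bullet> (h *v (J *v Y))) = \<mu> * (t \<bullet> v) * (X \<bullet> (g *v (J *v Y)))"
      using wedge12_contract[OF eq, of X Y v] that by (simp add: a s matrix_vector_mul_assoc[symmetric])
    then show ?thesis using tv a(2) by (simp add: field_simps)
  qed note ker = this
  have tw: "t \<bullet> w = 0" "t \<bullet> (J *v w) = 0" "t \<bullet> (J *v v) = 0"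
    using w g_J[of w v] g_self_J[of v] by (simp_all add: t(1)[symmetric] inner_commute)
  have X: "X \<bullet> (h *v w) = (\<mu> / c) * (X \<bullet> (g *v w))" if "t \<bullet> X = 0" for X
    using ker[OF that, of "- (J *v w)"] tw by (simp add: J_J matrix_vector_minus_right)
  \<comment> \<open>The vector \<open>v\<close> is outside the kernel of \<open>t\<close>, but
    \<open>J *v v\<close> is inside; invariance under \<open>J\<close> transfers the identity from
    \<open>J *v v\<close>, \<open>J *v w\<close> to \<open>v\<close>, \<open>w\<close>.\<close>
  have v: "v \<bullet> (h *v w) = (\<mu> / c) * (v \<bullet> (g *v w))"
    using ker[OF tw(3,1)] by (simp add: J_invariant_form[OF h] g_JJ)
  show ?thesis
  proof (rule vector_eq_ldot[THEN iffD1], rule allI)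
    fix Z
    have "t \<bullet> (Z - ((t \<bullet> Z) / (t \<bullet> v)) *\<^sub>R v) = 0" using tv by (simp add: inner_diff_right)
    from X[OF this] v show "Z \<bullet> (h *v w) = Z \<bullet> ((\<mu> / c) *\<^sub>R (g *v w))"
      by (simp add: inner_diff_left algebra_simps)
  qed
qed

text \<open>The vectors \<open>v\<close>, \<open>J *v v\<close>, \<open>w\<close>,
  \<open>J *v w\<close> form a \<open>g\<close>-orthogonal basis. The covector \<open>h *v w\<close>
  kills the first two because \<open>v\<close> is an eigenvector and \<open>h\<close> is
  \<open>J\<close>-invariant, and it kills \<open>J *v w\<close> because \<open>h\<close> composed
  with \<open>J\<close> is antisymmetric.\<close>

lemma eigenvector_dim4:
  fixes v w :: "real^'n"
  assumes n: "CARD('n) = 4" and v: "v \<noteq> 0" "h *v v = \<mu> *\<^sub>R (g *v v)"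
    and h: "transpose J ** h ** J = h" and h_sym: "transpose h = h"
    and w: "w \<noteq> 0" "w \<bullet> (g *v v) = 0" "w \<bullet> (g *v (J *v v)) = 0"
  shows "\<exists>l. h *v w = l *\<^sub>R (g *v w)"
proof -
  let ?B = "{v, J *v v, w, J *v w}"
  have h_commute: "X \<bullet> (h *v Y) = Y \<bullet> (h *v X)" for X Y
    by (metis dot_matrix_transpose h_sym inner_commute)
  have o: "v \<bullet> (g *v w) = 0" "v \<bullet> (g *v (J *v w)) = 0" "(J *v v) \<bullet> (g *v w)
      = 0" "(J *v v) \<bullet> (g *v (J *v w)) = 0"
    "(J *v w) \<bullet> (g *v v) = 0" "(J *v w) \<bullet> (g *v (J *v v)) = 0"
    using w(2,3) g_commute[of v w] g_J[of w v] g_commute[of v "J *v w"] g_commute[of "J *v v" w]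
    by (simp_all add: g_JJ)
  have pos: "x \<bullet> (g *v x) > 0" if "x \<in> ?B" for x
    using that v(1) w(1) by (auto intro!: g_pos dest: J_nonzero)
  have orth: "x \<bullet> (g *v y) = 0" if "x \<in> ?B" "y \<in> ?B" "x \<noteq> y" for x y
    using that o w(2,3) by (auto simp: g_self_J)
  have "independent ?B"
    using pos orth by (intro independent_if_orthogonal[of _ g]) (auto simp: less_le)
  moreover have "card ?B = 4"
  proof -
    have "v \<noteq> w" "v \<noteq> J *v w" "J *v v \<noteq> w" "J *v v \<noteq> J *v w"
      using o w(2) g_JJ[of v v] g_pos[OF v(1)] g_pos[OF w(1)] by (metis less_irrefl)+
    moreover have "J *v x \<noteq> x" if "x \<noteq> 0" for x
      using g_self_J(1)[of x] g_pos[OF that] by auto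
    ultimately have "distinct [v, J *v v, w, J *v w]" using v(1) w(1) by (simp, metis)
    then show ?thesis using distinct_card by fastforce
  qed
  ultimately have span: "span ?B = UNIV"
    using card_ge_dim_independent[of ?B UNIV] n by (simp add: subset_antisym)
  \<comment> \<open>The only possible eigenvalue: pair \<open>h *v w\<close> with
    \<open>w\<close>.\<close>
  define l where "l = (w \<bullet> (h *v w)) / (w \<bullet> (g *v w))"
  have "subspace {z. z \<bullet> (h *v w - l *\<^sub>R (g *v w)) = 0}"
    by (rule subspaceI) (auto simp: inner_add_left)
  moreover have "?B \<subseteq> {z. z \<bullet> (h *v w - l *\<^sub>R (g *v w)) = 0}"
  proof -
    have "v \<bullet> (h *v w) = 0" using h_commute[of v w] v(2) w(2) by simp
    moreover have "(J *v v) \<bullet> (h *v w) = 0"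
      using J_skew_form[OF h, of v w] h_commute[of v "J *v w"] v(2) o by simp
    moreover have "(J *v w) \<bullet> (h *v w) = 0"
      using J_skew_form[OF h, of w w] h_commute[of w "J *v w"] by simp
    moreover have "w \<bullet> (h *v w) = l * (w \<bullet> (g *v w))" using g_pos[OF w(1)] by (simp add: l_def)
    ultimately show ?thesis using o by (auto simp: inner_diff_right g_self_J)
  qed
  ultimately have "span ?B \<subseteq> {z. z \<bullet> (h *v w - l *\<^sub>R (g *v w)) = 0}" by (rule span_minimal[rotated])
  \<comment> \<open>A covector that annihilates every vector is in particular orthogonal to
    itself.\<close>
  then have "(h *v w - l *\<^sub>R (g *v w)) \<bullet> (h *v w - l *\<^sub>R (g *v w)) = 0" unfolding span by blast
  then show ?thesis by auto
qed

end

subsection \<open>Kaehler curvature tensors\<close>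

text \<open>Curvature at one point: \<open>R i j\<close> is the endomorphism attached to two
  coordinate directions, and its entry \<open>l\<close>, \<open>k\<close> is the component
  \<open>l\<close> of its value on the basis vector \<open>k\<close>. Pair symmetry is derived below
  from these axioms.\<close>

locale kahler_curvature = hermitian_space g J for g J :: "real^'n^'n" +
  fixes R :: "'n \<Rightarrow> 'n \<Rightarrow> real^'n^'n"
  assumes R_anti: "R i j = - R j i"
    and R_bianchi: "R i j $ l $ k + R j k $ l $ i + R k i $ l $ j = 0"
    and R_skew: "g ** R i j + transpose (R i j) ** g = 0"
    and R_J: "R i j ** J = J ** R i j"
begin

definition Rm :: "real^'n \<Rightarrow> real^'n \<Rightarrow> real^'n^'n" where
  "Rm X Y = (\<Sum>i\<in>UNIV. \<Sum>j\<in>UNIV. (X $ i * Y $ j) *\<^sub>R R i j)"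

definition ric :: "real^'n^'n" where
  "ric = (\<chi> j k. \<Sum>i\<in>UNIV. R i j $ i $ k)"

lemma Rm_nth: "Rm X Y $ l $ k = (\<Sum>i\<in>UNIV. \<Sum>j\<in>UNIV. X $ i * Y $ j * R i j $ l $ k)"
  by (simp add: Rm_def)

lemma Rm_mult: "(Rm X Y *v Z) $ l = (\<Sum>i\<in>UNIV. \<Sum>j\<in>UNIV. \<Sum>k\<in>UNIV. X $ i * Y $ j * Z $ k * R i j $ l $ k)"
proof -
  have "(Rm X Y *v Z) $ l = (\<Sum>k\<in>UNIV. \<Sum>i\<in>UNIV. \<Sum>j\<in>UNIV. X $ i * Y $ j * Z $ k * R i j $ l $ k)"
    by (simp add: matrix_vector_mult_def Rm_nth sum_distrib_left sum_distrib_right mult_ac)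
  also have "\<dots> = (\<Sum>i\<in>UNIV. \<Sum>k\<in>UNIV. \<Sum>j\<in>UNIV. X $ i * Y $ j * Z $ k * R i j $ l $ k)"
    by (rule sum.swap)
  also have "\<dots> = (\<Sum>i\<in>UNIV. \<Sum>j\<in>UNIV. \<Sum>k\<in>UNIV. X $ i * Y $ j * Z $ k * R i j $ l $ k)"
    by (rule sum.cong[OF refl], rule sum.swap)
  finally show ?thesis .
qed

lemma Rm_axis: "Rm (axis i 1) (axis j 1) = R i j"
proof -
  have "(\<Sum>b\<in>UNIV. (axis i 1 $ a * axis j 1 $ b) *\<^sub>R R a b) = (if a = i then R a j else 0)" for a
    by (simp add: axis_def if_distrib[of "\<lambda>x. x *\<^sub>R _"] cong: if_cong)
  then show ?thesis by (simp add: Rm_def)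
qed

lemma linear_Rm: "linear (\<lambda>X. Rm X Y *v Z)"
  by (rule linearI) (simp_all add: vec_eq_iff Rm_mult algebra_simps sum.distrib sum_distrib_left)

lemma Rm_anti: "Rm Y X = - Rm X Y"
proof -
  have "Rm Y X = (\<Sum>j\<in>UNIV. \<Sum>i\<in>UNIV. (Y $ i * X $ j) *\<^sub>R R i j)"
    unfolding Rm_def by (rule sum.swap)
  also have "\<dots> = - Rm X Y"
    unfolding Rm_def sum_negf[symmetric]
    by (intro sum.cong refl) (subst R_anti, simp add: mult.commute)
  finally show ?thesis .
qed

lemma Rm_bianchi: "Rm X Y *v Z + Rm Y Z *v X + Rm Z X *v Y = 0"
proof -
  have "(Rm X Y *v Z) $ l + (Rm Y Z *v X) $ l + (Rm Z X *v Y) $ l = 0" for l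
  proof -
    have "(Rm Y Z *v X) $ l = (\<Sum>j\<in>UNIV. \<Sum>k\<in>UNIV. \<Sum>i\<in>UNIV. X $ i * Y $ j * Z $ k * R j k $ l $ i)"
      by (simp add: Rm_mult mult_ac)
    also have "\<dots> = (\<Sum>j\<in>UNIV. \<Sum>i\<in>UNIV. \<Sum>k\<in>UNIV. X $ i * Y $ j * Z $ k * R j k $ l $ i)"
      by (rule sum.cong[OF refl], rule sum.swap)
    also have "\<dots> = (\<Sum>i\<in>UNIV. \<Sum>j\<in>UNIV. \<Sum>k\<in>UNIV. X $ i * Y $ j * Z $ k * R j k $ l $ i)"
      by (rule sum.swap)
    finally have 1: "(Rm Y Z *v X) $ l = \<dots>" .
    have "(Rm Z X *v Y) $ l = (\<Sum>k\<in>UNIV. \<Sum>i\<in>UNIV. \<Sum>j\<in>UNIV. X $ i * Y $ j * Z $ k * R k i $ l $ j)"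
      by (simp add: Rm_mult mult_ac)
    also have "\<dots> = (\<Sum>i\<in>UNIV. \<Sum>k\<in>UNIV. \<Sum>j\<in>UNIV. X $ i * Y $ j * Z $ k * R k i $ l $ j)"
      by (rule sum.swap)
    also have "\<dots> = (\<Sum>i\<in>UNIV. \<Sum>j\<in>UNIV. \<Sum>k\<in>UNIV. X $ i * Y $ j * Z $ k * R k i $ l $ j)"
      by (rule sum.cong[OF refl], rule sum.swap)
    finally have 2: "(Rm Z X *v Y) $ l = \<dots>" .
    show ?thesis
      unfolding 1 2 unfolding Rm_mult sum.distrib[symmetric] distrib_left[symmetric] R_bianchi by simp
  qed
  then show ?thesis by (simp add: vec_eq_iff)
qed

lemma Rm_J: "Rm X Y ** J = J ** Rm X Y"
  by (simp add: Rm_def matrix_mult_sum_left matrix_mult_sum_right matrix_mult_scaleR R_J)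

lemma Rm_J_vec: "Rm X Y *v (J *v Z) = J *v (Rm X Y *v Z)"
  by (simp add: matrix_vector_mul_assoc Rm_J)

lemma Rm_skew: "g ** Rm X Y + transpose (Rm X Y) ** g = 0"
  unfolding Rm_def matrix_mult_sum_left matrix_mult_sum_right transpose_sum sum.distrib[symmetric]
    matrix_mult_scaleR transpose_scaleR scaleR_add_right[symmetric] R_skew by simp

lemma g_eqI: "(\<And>W. W \<bullet> (g *v X) = W \<bullet> (g *v Y)) \<Longrightarrow> X = Y"
proof -
  assume a: "\<And>W. W \<bullet> (g *v X) = W \<bullet> (g *v Y)"
  have "(X - Y) \<bullet> (g *v (X - Y)) = 0"
    using a[of "X - Y"] by (simp add: matrix_vector_mult_diff_distrib inner_diff_right)
  then show ?thesis using g_pos[of "X - Y"] by force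
qed

definition K :: "real^'n \<Rightarrow> real^'n \<Rightarrow> real^'n \<Rightarrow> real^'n \<Rightarrow> real" where
  "K X Y Z W = W \<bullet> (g *v (Rm X Y *v Z))"

lemma K_anti1: "K Y X Z W = - K X Y Z W"
  by (simp add: K_def Rm_anti[of Y X] matrix_vector_minus_left matrix_vector_minus_right)

lemma K_anti2: "K X Y W Z = - K X Y Z W"
proof -
  have "K X Y Z W = (transpose (Rm X Y) *v (g *v W)) \<bullet> Z"
    unfolding K_def by (metis dot_matrix_transpose g_commute inner_commute transpose_transpose)
  also have "\<dots> = Z \<bullet> ((transpose (Rm X Y) ** g) *v W)"
    by (simp add: matrix_vector_mul_assoc inner_commute)
  also have "transpose (Rm X Y) ** g = - (g ** Rm X Y)"
    using Rm_skew[of X Y] by (simp add: add_eq_0_iff)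
  finally show ?thesis unfolding K_def
    by (simp add: matrix_vector_mul_assoc matrix_vector_minus_left)
qed

lemma K_bianchi: "K X Y Z W + K Y Z X W + K Z X Y W = 0"
  unfolding K_def inner_add_right[symmetric] matrix_vector_right_distrib[symmetric] Rm_bianchi by simp

text \<open>The classical argument: the first Bianchi identity for the four cyclic shifts of the
  arguments, together with both antisymmetries, is a linear system that forces pair
  symmetry.\<close>

lemma K_pair: "K X Y Z W = K Z W X Y"
  using K_bianchi[of X Y Z W] K_bianchi[of Y Z W X] K_bianchi[of Z W X Y] K_bianchi[of W X Y Z]
    K_anti2[of Y Z W X] K_anti2[of Z W Y X] K_anti1[of Y W Z X]
    K_anti2[of Y W Z X] K_anti1[of X W Z Y] K_anti2[of X W Z Y] K_anti1[of Z X W Y] K_anti2[of Z X W Y]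
    K_anti1[of X W Y Z] K_anti2[of X Y W Z] by linarith

text \<open>Pair symmetry moves \<open>J *v X\<close> and \<open>J *v Y\<close> into the last two
  slots of \<open>K\<close>. There the curvature commutes with \<open>J\<close> and the metric
  absorbs both copies.\<close>

lemma Rm_JJ: "Rm (J *v X) (J *v Y) = Rm X Y"
proof -
  have "W \<bullet> (g *v (Rm (J *v X) (J *v Y) *v Z)) = W \<bullet> (g *v (Rm X Y *v Z))" for Z W
  proof -
    have "K (J *v X) (J *v Y) Z W = K Z W (J *v X) (J *v Y)" by (rule K_pair)
    also have "\<dots> = K Z W X Y" by (simp add: K_def Rm_J_vec g_JJ)
    also have "\<dots> = K X Y Z W" by (rule K_pair)
    finally show ?thesis by (simp add: K_def)
  qed
  then show ?thesis using g_eqI by (metis matrix_eq)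
qed

text \<open>With the Ricci tensor as a trace of an operator, index sums give way to cyclicity of the
  trace.\<close>

lemma ric_trace: "X \<bullet> (ric *v Y) = trace (matrix (\<lambda>Z. Rm Z X *v Y))"
proof -
  have "(\<Sum>b\<in>UNIV. \<Sum>j\<in>UNIV. \<Sum>k\<in>UNIV. axis i 1 $ b * X $ j * Y $ k * R b j $ i $ k)
      = (\<Sum>j\<in>UNIV. \<Sum>k\<in>UNIV. X $ j * Y $ k * R i j $ i $ k)" for i
  proof -
    have "(\<Sum>j\<in>UNIV. \<Sum>k\<in>UNIV. axis i 1 $ b * X $ j * Y $ k * R b j $ i $ k)
      = (if b = i then (\<Sum>j\<in>UNIV. \<Sum>k\<in>UNIV. X $ j * Y $ k * R i j $ i $ k) else 0)" for b
      by (simp add: axis_def)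
    then show ?thesis by simp
  qed
  then have "trace (matrix (\<lambda>Z. Rm Z X *v Y))
      = (\<Sum>i\<in>UNIV. \<Sum>j\<in>UNIV. \<Sum>k\<in>UNIV. X $ j * Y $ k * R i j $ i $ k)"
    by (simp add: trace_matrix Rm_mult)
  also have "\<dots> = (\<Sum>j\<in>UNIV. \<Sum>i\<in>UNIV. \<Sum>k\<in>UNIV. X $ j * Y $ k * R i j $ i $ k)"
    by (rule sum.swap)
  also have "\<dots> = (\<Sum>j\<in>UNIV. \<Sum>k\<in>UNIV. \<Sum>i\<in>UNIV. X $ j * Y $ k * R i j $ i $ k)"
    by (rule sum.cong[OF refl], rule sum.swap)
  also have "\<dots> = X \<bullet> (ric *v Y)"
    by (simp add: ric_def inner_vec_def matrix_vector_mult_def sum_distrib_left sum_distrib_right mult_ac)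
  finally show ?thesis by simp
qed

text \<open>Pull \<open>J\<close> out of the second argument, move it by cyclicity onto the traced
  variable, and cancel the two copies by \<open>Rm_JJ\<close>.\<close>

lemma ric_JJ: "(J *v X) \<bullet> (ric *v (J *v Y)) = X \<bullet> (ric *v Y)"
proof -
  have "(J *v X) \<bullet> (ric *v (J *v Y)) = trace (matrix (\<lambda>Z. J *v (Rm Z (J *v X) *v Y)))"
    by (simp add: ric_trace Rm_J_vec)
  also have "\<dots> = trace (matrix (\<lambda>Z. Rm (J *v Z) (J *v X) *v Y))"
    by (rule trace_matrix_comp[OF linear_Rm])
  finally show ?thesis by (simp add: Rm_JJ ric_trace)
qed

lemma ric_J_invariant: "transpose J ** ric ** J = ric"
  using ric_JJ by (intro matrix_eq_dot)
    (simp add: dot_matrix_transpose matrix_vector_mul_assoc[symmetric])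

text \<open>The first Bianchi identity splits \<open>Rm X Y *v Z\<close> into two terms with
  \<open>Z\<close> in the first slot; composing with \<open>J\<close> and tracing over
  \<open>Z\<close> turns each into a Ricci value. The Ricci form thus becomes a trace of curvature,
  to which the second Bianchi identity applies.\<close>

lemma trace_J_Rm: "trace (J ** Rm X Y) = Y \<bullet> (ric *v (J *v X)) - X \<bullet> (ric *v (J *v Y))"
proof -
  have b: "J *v (Rm X Y *v Z) = Rm Z Y *v (J *v X) - Rm Z X *v (J *v Y)" for Z
  proof -
    have "Rm X Y *v Z = - (Rm Y Z *v X) - Rm Z X *v Y"
      using Rm_bianchi[of X Y Z] by (simp add: algebra_simps eq_neg_iff_add_eq_0)
    also have "Rm Y Z *v X = - (Rm Z Y *v X)"
      using Rm_anti[of Y Z] by (simp add: matrix_vector_minus_left)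
    finally show ?thesis by (simp add: Rm_J_vec matrix_vector_mult_diff_distrib)
  qed
  have "trace (J ** Rm X Y) = trace (matrix (\<lambda>Z. J *v (Rm X Y *v Z)))"
    by (simp add: matrix_vector_mul_assoc)
  also have "\<dots> = trace (matrix (\<lambda>Z. Rm Z Y *v (J *v X))) - trace (matrix (\<lambda>Z. Rm Z X *v (J *v Y)))"
    by (simp add: b trace_matrix sum_subtractf)
  finally show ?thesis by (simp add: ric_trace)
qed

lemma trace_J_R: "trace (J ** R i j) = (ric ** J) $ j $ i - (ric ** J) $ i $ j"
proof -
  have "axis i 1 \<bullet> (ric *v (J *v axis j 1)) = (ric ** J) $ i $ j" for i j
    by (simp only: matrix_vector_mul_assoc) (simp add: matrix_vector_mult_basis column_def inner_axis')
  then show ?thesis using trace_J_Rm[of "axis i 1" "axis j 1"] by (simp add: Rm_axis)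
qed

end

subsection \<open>Coordinate derivatives of matrices and vectors\<close>

definition mpd :: "'n::finite \<Rightarrow> (real^'n \<Rightarrow> real^'p^'q) \<Rightarrow> real^'n \<Rightarrow> real^'p^'q" where
  "mpd k A x = (\<chi> i j. pd k (\<lambda>y. A y $ i $ j) x)"

definition vpd :: "'n::finite \<Rightarrow> (real^'n \<Rightarrow> real^'p) \<Rightarrow> real^'n \<Rightarrow> real^'p" where
  "vpd k v x = (\<chi> i. pd k (\<lambda>y. v y $ i) x)"

text \<open>Smoothness is asked entry by entry, so that matrix rules reduce to those for real
  functions.\<close>

definition smooth_mat :: "(real^'n::finite) set \<Rightarrow> (real^'n \<Rightarrow> real^'p^'q) \<Rightarrow> bool" where
  "smooth_mat S A \<longleftrightarrow> (\<forall>i j. smooth_on S (\<lambda>x. A x $ i $ j))"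

definition smooth_vec :: "(real^'n::finite) set \<Rightarrow> (real^'n \<Rightarrow> real^'p) \<Rightarrow> bool" where
  "smooth_vec S v \<longleftrightarrow> (\<forall>i. smooth_on S (\<lambda>x. v x $ i))"

lemma smooth_mat_of_smooth_on: "open S \<Longrightarrow> smooth_on S A \<Longrightarrow> smooth_mat S A"
  for A :: "real^'n::finite \<Rightarrow> real^'p^'q"
  unfolding smooth_mat_def by (intro allI smooth_on_nth) (auto intro: smooth_on_nth)

lemma smooth_mat_D: "smooth_mat S A \<Longrightarrow> smooth_on S (\<lambda>x. A x $ i $ j)"
  by (simp add: smooth_mat_def)

lemma smooth_vec_D: "smooth_vec S v \<Longrightarrow> smooth_on S (\<lambda>x. v x $ i)"
  by (simp add: smooth_vec_def)

lemma smooth_mat_mult: "open S \<Longrightarrow> smooth_mat S A \<Longrightarrow> smooth_mat S B \<Longrightarrow> smooth_mat S (\<lambda>x. A x ** B x)"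
  by (auto simp: smooth_mat_def matrix_matrix_mult_def intro!: smooth_on_sum smooth_on_mult)

lemma smooth_mat_add: "open S \<Longrightarrow> smooth_mat S A \<Longrightarrow> smooth_mat S B \<Longrightarrow> smooth_mat S (\<lambda>x. A x + B x)"
  by (auto simp: smooth_mat_def intro!: smooth_on_add)

lemma smooth_mat_diff: "open S \<Longrightarrow> smooth_mat S A \<Longrightarrow> smooth_mat S B \<Longrightarrow> smooth_mat S (\<lambda>x. A x - B x)"
  by (auto simp: smooth_mat_def intro!: smooth_on_diff)

lemma smooth_mat_transpose: "smooth_mat S A \<Longrightarrow> smooth_mat S (\<lambda>x. transpose (A x))"
  by (auto simp: smooth_mat_def transpose_def)

lemma smooth_mat_mpd: "smooth_mat S A \<Longrightarrow> smooth_mat S (mpd k A)"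
  by (auto simp: smooth_mat_def mpd_def intro!: smooth_on_pd)

lemma smooth_mat_cong:
  "open S \<Longrightarrow> (\<And>x. x \<in> S \<Longrightarrow> A x = B x) \<Longrightarrow> smooth_mat S A \<Longrightarrow> smooth_mat S B"
  unfolding smooth_mat_def by (metis (mono_tags, lifting) smooth_on_cong)

lemma smooth_vec_mult: "open S \<Longrightarrow> smooth_mat S A \<Longrightarrow> smooth_vec S v \<Longrightarrow> smooth_vec S (\<lambda>x. A x *v v x)"
  by (auto simp: smooth_mat_def smooth_vec_def matrix_vector_mult_def
      intro!: smooth_on_sum smooth_on_mult)

lemmas smooth_intros = smooth_mat_mult smooth_mat_add smooth_mat_diff smooth_mat_transpose
  smooth_mat_mpd smooth_vec_mult

lemma mpd_cong:
  "open S \<Longrightarrow> x \<in> S \<Longrightarrow> (\<And>y. y \<in> S \<Longrightarrow> A y = B y) \<Longrightarrow> mpd k A x = mpd k B x"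
  by (auto simp: mpd_def vec_eq_iff intro!: pd_cong)

lemma vpd_cong:
  "open S \<Longrightarrow> x \<in> S \<Longrightarrow> (\<And>y. y \<in> S \<Longrightarrow> A y = B y) \<Longrightarrow> vpd k A x = vpd k B x"
  by (auto simp: vpd_def vec_eq_iff intro!: pd_cong)

lemma mpd_commute:
  "open S \<Longrightarrow> x \<in> S \<Longrightarrow> smooth_mat S A \<Longrightarrow> mpd i (mpd j A) x = mpd j (mpd i A) x"
  by (auto simp: mpd_def vec_eq_iff smooth_mat_def intro!: pd_commute[unfolded pd_def]
      simp: pd_def[abs_def])

lemma mpd_add:
  assumes "x \<in> S" "smooth_mat S A" "smooth_mat S B"
  shows "mpd k (\<lambda>y. A y + B y) x = mpd k A x + mpd k B x"
  using assms
  by (auto simp: mpd_def vec_eq_iff smooth_mat_def intro!: pd_add smooth_on_differentiable[of S])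

lemma mpd_diff:
  assumes "x \<in> S" "smooth_mat S A" "smooth_mat S B"
  shows "mpd k (\<lambda>y. A y - B y) x = mpd k A x - mpd k B x"
  using assms
  by (auto simp: mpd_def vec_eq_iff smooth_mat_def intro!: pd_diff smooth_on_differentiable[of S])

lemma mpd_transpose: "mpd k (\<lambda>y. transpose (A y)) x = transpose (mpd k A x)"
  by (simp add: mpd_def transpose_def vec_eq_iff)

lemma mpd_mult:
  assumes "x \<in> S" "smooth_mat S A" "smooth_mat S B"
  shows "mpd k (\<lambda>y. A y ** B y) x = mpd k A x ** B x + A x ** mpd k B x"
proof -
  have d: "(\<lambda>y. A y $ i $ j) differentiable at x" "(\<lambda>y. B y $ l $ m) differentiable at x" for i j l m
    using assms by (auto simp: smooth_mat_def intro!: smooth_on_differentiable[of S])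
  have "pd k (\<lambda>y. \<Sum>m\<in>UNIV. A y $ i $ m * B y $ m $ j) x
    = (\<Sum>m\<in>UNIV. pd k (\<lambda>y. A y $ i $ m) x * B x $ m $ j + A x $ i $ m * pd k (\<lambda>y. B y $ m $ j) x)" for i j
    by (subst pd_sum) (auto intro!: sum.cong differentiable_mult d simp: pd_mult d)
  then show ?thesis
    by (simp add: vec_eq_iff mpd_def matrix_matrix_mult_def sum.distrib)
qed

lemma vpd_mult:
  assumes "x \<in> S" "smooth_mat S A" "smooth_vec S v"
  shows "vpd k (\<lambda>y. A y *v v y) x = mpd k A x *v v x + A x *v vpd k v x"
proof -
  have d: "(\<lambda>y. A y $ i $ j) differentiable at x" "(\<lambda>y. v y $ l) differentiable at x" for i j l
    using assms by (auto simp: smooth_mat_def smooth_vec_def intro!: smooth_on_differentiable[of S])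
  have "pd k (\<lambda>y. \<Sum>m\<in>UNIV. A y $ i $ m * v y $ m) x
    = (\<Sum>m\<in>UNIV. pd k (\<lambda>y. A y $ i $ m) x * v x $ m + A x $ i $ m * pd k (\<lambda>y. v y $ m) x)" for i
    by (subst pd_sum) (auto intro!: sum.cong differentiable_mult d simp: pd_mult d)
  then show ?thesis
    by (simp add: vec_eq_iff mpd_def vpd_def matrix_vector_mult_def sum.distrib)
qed

lemma pd_inner:
  assumes "x \<in> S" "smooth_vec S u" "smooth_vec S v"
  shows "pd k (\<lambda>y. u y \<bullet> v y) x = vpd k u x \<bullet> v x + u x \<bullet> vpd k v x"
proof -
  have d: "(\<lambda>y. u y $ j) differentiable at x" "(\<lambda>y. v y $ l) differentiable at x" for j l
    using assms by (auto simp: smooth_vec_def intro!: smooth_on_differentiable[of S])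
  have "pd k (\<lambda>y. \<Sum>m\<in>UNIV. u y $ m * v y $ m) x
    = (\<Sum>m\<in>UNIV. pd k (\<lambda>y. u y $ m) x * v x $ m + u x $ m * pd k (\<lambda>y. v y $ m) x)"
    by (subst pd_sum) (auto intro!: sum.cong differentiable_mult d simp: pd_mult d)
  then show ?thesis
    by (simp add: inner_vec_def vpd_def sum.distrib)
qed

lemma pd_trace:
  assumes "x \<in> S" "smooth_mat S A"
  shows "pd k (\<lambda>y. trace (A y)) x = trace (mpd k A x)"
  using assms unfolding trace_def
  by (subst pd_sum) (auto simp: mpd_def smooth_mat_def intro!: smooth_on_differentiable[of S])

text \<open>For a 2-form \<open>B\<close>, \<open>ext_deriv B k i j\<close> is the component $(dB)_{kij}$.\<close>

definition ext_deriv :: "(real^'n::finite \<Rightarrow> real^'n^'n) \<Rightarrow> 'n \<Rightarrow> 'n \<Rightarrow> 'n \<Rightarrow> real^'n \<Rightarrow> real" where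
  "ext_deriv B k i j x = mpd k B x $ i $ j + mpd i B x $ j $ k + mpd j B x $ k $ i"

text \<open>The Leibniz rule d(fB) = df \<and> B + f dB.\<close>

lemma ext_deriv_scaleR:
  assumes "x \<in> S" "smooth_mat S B" "f differentiable at x"
  shows "ext_deriv (\<lambda>y. f y *\<^sub>R B y) k i j x
      = wedge12 (differential f x) (B x) k i j + f x * ext_deriv B k i j x"
proof -
  have d: "(\<lambda>y. B y $ i $ j) differentiable at x" for i j
    using assms by (auto simp: smooth_mat_def intro!: smooth_on_differentiable[of S])
  show ?thesis
    by (simp add: ext_deriv_def wedge12_def mpd_def differential_def pd_mult d assms algebra_simps)
qed

lemma ext_deriv_add:
  assumes "x \<in> S" "smooth_mat S A" "smooth_mat S B"
  shows "ext_deriv (\<lambda>y. A y + B y) k i j x = ext_deriv A k i j x + ext_deriv B k i j x"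
  using assms by (simp add: ext_deriv_def mpd_add[of x S])

lemma ext_deriv_cong:
  "open S \<Longrightarrow> x \<in> S \<Longrightarrow> (\<And>y. y \<in> S \<Longrightarrow> A y = B y) \<Longrightarrow> ext_deriv A k i j x = ext_deriv B k i j x"
  unfolding ext_deriv_def by (metis mpd_cong)

lemma antisym_matrix_nth: "A = - transpose A \<Longrightarrow> A $ i $ j = - A $ j $ i" for A :: "real^'n^'n"
  by (drule arg_cong[of _ _ "\<lambda>M. M $ i $ j"]) (simp add: transpose_def)

lemma sym_matrix_nth: "transpose A = A \<Longrightarrow> A $ i $ j = A $ j $ i"
  by (drule arg_cong[of _ _ "\<lambda>M. M $ j $ i"]) (simp add: transpose_def)

subsection \<open>Kaehler metrics in one coordinate system\<close>

text \<open>A Kaehler metric on the image \<open>S\<close> of one chart; the differential calculus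
  takes place here.\<close>

locale kahler_coords =
  fixes S :: "(real^'n::finite) set" and g J :: "real^'n \<Rightarrow> real^'n^'n"
  assumes S_open: "open S"
    and g_smooth_on: "smooth_on S g" and J_smooth_on: "smooth_on S J"
    and metric_sym: "x \<in> S \<Longrightarrow> transpose (g x) = g x"
    and metric_pos: "x \<in> S \<Longrightarrow> u \<noteq> 0 \<Longrightarrow> u \<bullet> (g x *v u) > 0"
    and cplx_sq: "x \<in> S \<Longrightarrow> J x ** J x = - mat 1"
    and cplx_orth: "x \<in> S \<Longrightarrow> transpose (J x) ** g x ** J x = g x"
    and cplx_parallel: "x \<in> S \<Longrightarrow> cov_deriv_endo g J k x = 0"
begin

lemma g_smooth: "smooth_mat S g"
  by (rule smooth_mat_of_smooth_on[OF S_open g_smooth_on])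

lemma J_smooth: "smooth_mat S J"
  by (rule smooth_mat_of_smooth_on[OF S_open J_smooth_on])

lemma g_inverse: "x \<in> S \<Longrightarrow> g x ** matrix_inv (g x) = mat 1" "x \<in> S \<Longrightarrow> matrix_inv (g x) ** g x = mat 1"
  using matrix_inv_mult[OF pos_def_invertible] metric_pos by blast+

lemma g_inv_smooth: "smooth_mat S (\<lambda>x. matrix_inv (g x))"
  unfolding smooth_mat_def
  using smooth_on_matrix_inv[OF S_open smooth_mat_D[OF g_smooth] pos_def_invertible] metric_pos by blast

lemma christoffel_smooth: "smooth_on S (christoffel g k i j)"
  unfolding christoffel_def[abs_def]
  by (intro smooth_on_divide smooth_on_sum smooth_on_mult smooth_on_add smooth_on_diff smooth_on_pd
      smooth_on_const S_open smooth_mat_D[OF g_smooth] smooth_mat_D[OF g_inv_smooth]) simp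

text \<open>Multiply the invariance by \<open>J x\<close> on the right and use that
  \<open>J x\<close> squares to minus the identity. For symmetric \<open>B\<close> the conclusion
  says that \<open>B ** J x\<close> is a 2-form.\<close>

lemma J_anti_invariant:
  assumes "x \<in> S" "transpose (J x) ** B ** J x = B"
  shows "B ** J x = - (transpose (J x) ** B)"
proof -
  have "transpose (J x) ** B ** J x ** J x = B ** J x" using assms by simp
  then show ?thesis
    by (simp add: matrix_mul_assoc[symmetric] cplx_sq[OF assms(1)] matrix_minus_right)
qed

text \<open>The connection matrix in direction \<open>i\<close>: the covariant derivative of a
  vector field has components \<open>vpd i v x + Gam i x *v v x\<close>.\<close>

definition Gam :: "'n \<Rightarrow> real^'n \<Rightarrow> real^'n^'n" where
  "Gam i x = (\<chi> l m. christoffel g l i m x)"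

lemma Gam_smooth: "smooth_mat S (Gam i)"
  using christoffel_smooth by (simp add: smooth_mat_def Gam_def)

section \<open>The Levi-Civita connection: no torsion, parallel metric, parallel complex
  structure\<close>

lemma pd_metric_sym: "x \<in> S \<Longrightarrow> pd k (\<lambda>y. g y $ i $ j) x = pd k (\<lambda>y. g y $ j $ i) x"
proof (rule pd_cong[OF S_open])
  fix y assume "y \<in> S"
  from metric_sym[OF this] show "g y $ i $ j = g y $ j $ i"
    by (rule sym_matrix_nth)
qed

lemma christoffel_sym: "x \<in> S \<Longrightarrow> christoffel g k i j x = christoffel g k j i x"
  unfolding christoffel_def using pd_metric_sym[of x _ i j] by (simp add: add.commute)

lemma christoffel_lower:
  assumes "x \<in> S"
  shows "(g x ** Gam k x) $ i $ j
    = (pd k (\<lambda>y. g y $ j $ i) x + pd j (\<lambda>y. g y $ k $ i) x - pd i (\<lambda>y. g y $ k $ j) x) / 2"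
proof -
  let ?c = "\<chi> l. (pd k (\<lambda>y. g y $ j $ l) x + pd j (\<lambda>y. g y $ k $ l) x - pd l (\<lambda>y. g y $ k $ j) x) / 2"
  have "christoffel g m k j x = (matrix_inv (g x) *v ?c) $ m" for m
    by (simp add: christoffel_def matrix_vector_mult_def sum_divide_distrib)
  then have "(g x ** Gam k x) $ i $ j = (g x *v (matrix_inv (g x) *v ?c)) $ i"
    by (simp add: matrix_matrix_mult_def Gam_def matrix_vector_mult_def[of "g x"])
  also have "\<dots> = ?c $ i" using g_inverse[OF assms] by (simp add: matrix_vector_mul_assoc)
  finally show ?thesis by simp
qed

text \<open>The metric is parallel. With the index lowered, the Christoffel symbols are those of the
  first kind, and symmetrising them leaves one derivative of the metric.\<close>

lemma mpd_g:
  assumes "x \<in> S"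
  shows "mpd k g x = g x ** Gam k x + transpose (Gam k x) ** g x"
proof -
  have t: "(transpose (Gam k x) ** g x) $ i $ j = (g x ** Gam k x) $ j $ i" for i j
  proof -
    have "transpose (Gam k x) ** g x = transpose (g x ** Gam k x)"
      by (simp add: matrix_transpose_mul metric_sym[OF assms])
    then show ?thesis by (simp add: transpose_def)
  qed
  have "pd k (\<lambda>y. g y $ i $ j) x = (g x ** Gam k x) $ i $ j + (g x ** Gam k x) $ j $ i" for i j
    using pd_metric_sym[OF assms, of k i j] by (simp add: christoffel_lower[OF assms] field_simps)
  then show ?thesis by (simp add: vec_eq_iff mpd_def t)
qed

lemma mpd_J:
  assumes "x \<in> S"
  shows "mpd k J x = J x ** Gam k x - Gam k x ** J x"
proof -
  have "pd k (\<lambda>y. J y $ i $ j) x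
      + (\<Sum>l\<in>UNIV. christoffel g i k l x * J x $ l $ j - christoffel g l k j x * J x $ i $ l) = 0" for i j
    using cplx_parallel[OF assms, of k] by (simp add: cov_deriv_endo_def vec_eq_iff)
  then show ?thesis
    by (simp add: vec_eq_iff mpd_def matrix_matrix_mult_def Gam_def sum_subtractf mult.commute)
      (metis (no_types, lifting) add_diff_cancel_left' diff_0 minus_diff_eq add.commute)
qed

section \<open>Symmetries of the curvature\<close>

definition Rie :: "'n \<Rightarrow> 'n \<Rightarrow> real^'n \<Rightarrow> real^'n^'n" where
  "Rie i j x = (\<chi> l k. riemann g l k i j x)"

text \<open>The curvature is the commutator of the operators \<open>mpd i\<close> +
  \<open>Gam i\<close> and \<open>mpd j\<close> + \<open>Gam j\<close>; in this form it can be
  handled with matrix algebra.\<close>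

lemma Rie_eq: "Rie i j x = mpd i (Gam j) x - mpd j (Gam i) x + Gam i x ** Gam j x - Gam j x ** Gam i x"
  by (simp add: Rie_def riemann_def vec_eq_iff mpd_def Gam_def matrix_matrix_mult_def sum_subtractf)

lemma Rie_smooth: "smooth_mat S (Rie i j)"
  unfolding Rie_eq[abs_def] by (intro smooth_intros S_open Gam_smooth)

lemma Rie_anti: "Rie i j x = - Rie j i x"
  by (simp add: Rie_eq)

lemma Rie_bianchi1:
  assumes "x \<in> S"
  shows "Rie i j x $ l $ k + Rie j k x $ l $ i + Rie k i x $ l $ j = 0"
proof -
  have "pd a (christoffel g l b c) x = pd a (christoffel g l c b) x" for a b c
    by (rule pd_cong[OF S_open assms]) (rule christoffel_sym)
  from this[of i j k] this[of j i k] this[of k i j] show ?thesis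
    using christoffel_sym[OF assms, of _ j i] christoffel_sym[OF assms, of _ k i]
        christoffel_sym[OF assms, of _ k j]
    by (simp add: Rie_def riemann_def sum_subtractf)
qed

text \<open>The integrability condition of \<open>mpd_J\<close>: differentiate it once more and
  equate the mixed second derivatives of \<open>J\<close>.\<close>

lemma Rie_J:
  assumes "x \<in> S"
  shows "Rie i k x ** J x = J x ** Rie i k x"
proof -
  note sm = S_open assms J_smooth Gam_smooth
  have e: "mpd i (mpd k J) x = (J x ** Gam i x - Gam i x ** J x) ** Gam k x + J x ** mpd i (Gam k) x
      - (mpd i (Gam k) x ** J x + Gam k x ** (J x ** Gam i x - Gam i x ** J x))" for i k
  proof -
    have "mpd i (mpd k J) x = mpd i (\<lambda>x. J x ** Gam k x - Gam k x ** J x) x"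
      by (rule mpd_cong[OF S_open assms]) (rule mpd_J)
    also have "\<dots> = mpd i (\<lambda>x. J x ** Gam k x) x - mpd i (\<lambda>x. Gam k x ** J x) x"
      by (intro mpd_diff[OF assms] smooth_intros sm)
    finally show ?thesis
      by (simp add: mpd_mult[OF assms J_smooth Gam_smooth] mpd_mult[OF assms Gam_smooth J_smooth]
          mpd_J assms)
  qed
  have "mpd i (mpd k J) x = mpd k (mpd i J) x" by (rule mpd_commute[OF S_open assms J_smooth])
  then show ?thesis unfolding e Rie_eq by (simp add: matrix_ring_simps algebra_simps)
qed

text \<open>The same integrability argument, applied to \<open>mpd_g\<close>.\<close>

lemma Rie_skew:
  assumes "x \<in> S"
  shows "g x ** Rie i k x + transpose (Rie i k x) ** g x = 0"
proof -
  note sm = S_open assms g_smooth Gam_smooth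
  have e: "mpd i (mpd k g) x = (g x ** Gam i x + transpose (Gam i x) ** g x) ** Gam k x
      + g x ** mpd i (Gam k) x
      + (transpose (mpd i (Gam k) x) ** g x + transpose (Gam k x) ** (g x ** Gam i x
          + transpose (Gam i x) ** g x))" for i k
  proof -
    have "mpd i (mpd k g) x = mpd i (\<lambda>x. g x ** Gam k x + transpose (Gam k x) ** g x) x"
      by (rule mpd_cong[OF S_open assms]) (rule mpd_g)
    also have "\<dots> = mpd i (\<lambda>x. g x ** Gam k x) x + mpd i (\<lambda>x. transpose (Gam k x) ** g x) x"
      by (intro mpd_add[OF assms] smooth_intros sm)
    finally show ?thesis
      by (simp add: mpd_mult[OF assms g_smooth Gam_smooth] mpd_transpose
          mpd_mult[OF assms smooth_mat_transpose[OF Gam_smooth] g_smooth] mpd_g assms)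
  qed
  have "mpd i (mpd k g) x = mpd k (mpd i g) x" by (rule mpd_commute[OF S_open assms g_smooth])
  then show ?thesis unfolding e Rie_eq by (simp add: matrix_ring_simps algebra_simps)
qed

lemma curvature: "x \<in> S \<Longrightarrow> kahler_curvature (g x) (J x) (\<lambda>i j. Rie i j x)"
  by unfold_locales (simp_all add: metric_sym metric_pos cplx_sq cplx_orth Rie_bianchi1 Rie_skew
      Rie_J Rie_anti[of _ _ x, symmetric])

lemma ric_eq: "x \<in> S \<Longrightarrow> kahler_curvature.ric (\<lambda>i j. Rie i j x) = ricci g x"
  unfolding ricci_def by (subst kahler_curvature.ric_def[OF curvature]) (simp_all add: Rie_def)

lemma ricci_J_invariant: "x \<in> S \<Longrightarrow> transpose (J x) ** ricci g x ** J x = ricci g x"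
  using kahler_curvature.ric_J_invariant[OF curvature] ric_eq by metis

lemma trace_J_Rie:
  "x \<in> S \<Longrightarrow> trace (J x ** Rie i j x) = (ricci g x ** J x) $ j $ i - (ricci g x ** J x) $ i $ j"
  using kahler_curvature.trace_J_R[OF curvature] ric_eq by metis

text \<open>Each bracketed term is the covariant derivative with respect to the endomorphism indices
  only; the Christoffel corrections for the two form indices would cancel in the cyclic sum. After
  expanding by \<open>Rie_eq\<close>, second derivatives cancel by their symmetry and the remaining
  products cancel algebraically.\<close>

lemma Rie_bianchi2:
  assumes "x \<in> S"
  shows "(mpd k (Rie i j) x + Gam k x ** Rie i j x - Rie i j x ** Gam k x)
    + (mpd i (Rie j k) x + Gam i x ** Rie j k x - Rie j k x ** Gam i x)
    + (mpd j (Rie k i) x + Gam j x ** Rie k i x - Rie k i x ** Gam j x) = 0"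
proof -
  have e: "mpd k (Rie i j) x = mpd k (mpd i (Gam j)) x - mpd k (mpd j (Gam i)) x
      + (mpd k (Gam i) x ** Gam j x + Gam i x ** mpd k (Gam j) x)
      - (mpd k (Gam j) x ** Gam i x + Gam j x ** mpd k (Gam i) x)" for i j k
  proof -
    note sm = S_open assms Gam_smooth
    have "mpd k (Rie i j) x = mpd k (\<lambda>x. mpd i (Gam j) x - mpd j (Gam i) x + Gam i x ** Gam j x) x
        - mpd k (\<lambda>x. Gam j x ** Gam i x) x"
      unfolding Rie_eq[abs_def] by (intro mpd_diff[OF assms] smooth_intros sm)
    also have "mpd k (\<lambda>x. mpd i (Gam j) x - mpd j (Gam i) x + Gam i x ** Gam j x) x
        = mpd k (\<lambda>x. mpd i (Gam j) x - mpd j (Gam i) x) x + mpd k (\<lambda>x. Gam i x ** Gam j x) x"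
      by (intro mpd_add[OF assms] smooth_intros sm)
    also have "mpd k (\<lambda>x. mpd i (Gam j) x - mpd j (Gam i) x) x
        = mpd k (\<lambda>x. mpd i (Gam j) x) x - mpd k (\<lambda>x. mpd j (Gam i) x) x"
      by (intro mpd_diff[OF assms] smooth_intros sm)
    finally show ?thesis by (simp add: mpd_mult[OF assms Gam_smooth Gam_smooth])
  qed
  have c: "mpd a (mpd b (Gam c)) x = mpd b (mpd a (Gam c)) x" for a b c
    by (rule mpd_commute[OF S_open assms Gam_smooth])
  show ?thesis
    unfolding e Rie_eq using c[of k i] c[of k j] c[of i j]
    by (simp add: matrix_ring_simps algebra_simps)
qed

text \<open>The Ricci form is a multiple of the trace of \<open>J\<close> composed with curvature.
  As \<open>J\<close> is parallel, differentiating this trace differentiates the curvature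
  covariantly, and the cyclic sum vanishes by the second Bianchi identity.\<close>

lemma ricci_form_closed:
  assumes "x \<in> S" and sym: "\<And>y. y \<in> S \<Longrightarrow> transpose (ricci g y) = ricci g y"
  shows "ext_deriv (\<lambda>y. ricci g y ** J y) k i j x = 0"
proof -
  let ?T = "\<lambda>i j y. trace (J y ** Rie i j y)"
  \<comment> \<open>Symmetry of the Ricci tensor makes \<open>ricci g y ** J y\<close>
    antisymmetric, so the difference in \<open>trace_J_Rie\<close> is minus twice one entry.\<close>
  have r: "(ricci g y ** J y) $ i $ j = (- 1 / 2) * ?T i j y" if "y \<in> S" for i j y
  proof -
    have "ricci g y ** J y = - (transpose (J y) ** ricci g y)"
      by (rule J_anti_invariant[OF that ricci_J_invariant[OF that]])
    also have "\<dots> = - transpose (ricci g y ** J y)"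
      by (simp add: matrix_transpose_mul sym[OF that])
    finally have "(ricci g y ** J y) $ i $ j = - (ricci g y ** J y) $ j $ i"
      by (rule antisym_matrix_nth)
    then show ?thesis by (simp add: trace_J_Rie[OF that])
  qed
  have T: "pd k (?T i j) x = trace (J x ** (mpd k (Rie i j) x
      + Gam k x ** Rie i j x - Rie i j x ** Gam k x))" for i j k
  proof -
    have "pd k (?T i j) x = trace (mpd k J x ** Rie i j x + J x ** mpd k (Rie i j) x)"
      by (subst pd_trace[OF assms(1)]) (auto intro: smooth_intros S_open J_smooth Rie_smooth
          simp: mpd_mult[OF assms(1) J_smooth Rie_smooth])
    \<comment> \<open>Cyclicity turns the commutator of \<open>Gam k x\<close> with
      \<open>J x\<close> into a commutator with the curvature.\<close>
    also have "trace (Gam k x ** (J x ** Rie i j x)) = trace ((J x ** Rie i j x) ** Gam k x)"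
      by (rule trace_mul_sym)
    then have "trace (mpd k J x ** Rie i j x + J x ** mpd k (Rie i j) x)
      = trace (J x ** (mpd k (Rie i j) x + Gam k x ** Rie i j x - Rie i j x ** Gam k x))"
      by (simp add: mpd_J[OF assms(1)] trace_add trace_sub matrix_ring_simps)
    finally show ?thesis .
  qed
  have d: "?T i j differentiable at x" for i j
    unfolding trace_def using smooth_mat_mult[OF S_open J_smooth Rie_smooth]
    by (intro smooth_on_differentiable[OF _ assms(1)] smooth_on_sum S_open) (rule smooth_mat_D)
  have "mpd k (\<lambda>y. ricci g y ** J y) x $ i $ j = (- 1 / 2) * pd k (?T i j) x" for i j k
  proof -
    have "mpd k (\<lambda>y. ricci g y ** J y) x $ i $ j = pd k (\<lambda>y. (- 1 / 2) * ?T i j y) x"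
      unfolding mpd_def by (simp, rule pd_cong[OF S_open assms(1)]) (use r in simp)
    then show ?thesis by (subst (asm) pd_mult) (auto simp: d pd_const)
  qed
  then have "ext_deriv (\<lambda>y. ricci g y ** J y) k i j x
    = (- 1 / 2) * (pd k (?T i j) x + pd i (?T j k) x + pd j (?T k i) x)"
    by (simp add: ext_deriv_def algebra_simps)
  also have "pd k (?T i j) x + pd i (?T j k) x + pd j (?T k i) x = trace (J x ** (
      (mpd k (Rie i j) x + Gam k x ** Rie i j x - Rie i j x ** Gam k x)
    + (mpd i (Rie j k) x + Gam i x ** Rie j k x - Rie j k x ** Gam i x)
    + (mpd j (Rie k i) x + Gam j x ** Rie k i x - Rie k i x ** Gam j x)))"
    unfolding T by (simp only: trace_add[symmetric] matrix_add_ldistrib[symmetric])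
  also have "\<dots> = 0" unfolding Rie_bianchi2[OF assms(1)] by (simp add: trace_def)
  finally show ?thesis by simp
qed

text \<open>The Kaehler form is parallel, so its derivatives consist of Christoffel terms; these
  cancel in the cyclic sum because the form is antisymmetric and the connection has no
  torsion.\<close>

lemma kahler_form_closed:
  assumes "x \<in> S"
  shows "ext_deriv (\<lambda>y. g y ** J y) k i j x = 0"
proof -
  let ?w = "g x ** J x"
  have "?w = - (transpose (J x) ** g x)"
    by (rule J_anti_invariant[OF assms cplx_orth[OF assms]])
  also have "\<dots> = - transpose ?w" by (simp add: matrix_transpose_mul metric_sym[OF assms])
  finally have anti: "?w $ a $ b = - ?w $ b $ a" for a b
    by (rule antisym_matrix_nth)
  have d: "mpd k (\<lambda>y. g y ** J y) x = ?w ** Gam k x + transpose (Gam k x) ** ?w" for k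
    using mpd_mult[OF assms g_smooth J_smooth, of k]
    by (simp add: mpd_g[OF assms] mpd_J[OF assms] matrix_ring_simps)
  have "mpd k (\<lambda>y. g y ** J y) x $ i $ j
      = (\<Sum>m\<in>UNIV. ?w $ i $ m * christoffel g m k j x - ?w $ j $ m * christoffel g m k i x)"
    for i j k
  proof -
    have *: "(transpose A ** W) $ i $ j = - (\<Sum>m\<in>UNIV. W $ j $ m * A $ m $ i)"
      if "\<And>a. W $ a $ j = - W $ j $ a" for A W :: "real^'n^'n"
      by (simp add: matrix_matrix_mult_def transpose_def that sum_negf mult.commute)
    show ?thesis
      using *[OF anti, of "Gam k x"] d[of k]
      by (simp add: matrix_matrix_mult_def[of ?w] sum_subtractf Gam_def)
  qed
  then show ?thesis
    using christoffel_sym[OF assms, of _ j i] christoffel_sym[OF assms, of _ k i]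
        christoffel_sym[OF assms, of _ k j]
    by (simp add: ext_deriv_def sum_subtractf)
qed

end

subsection \<open>Hessians and gradients\<close>

context kahler_coords
begin

context
  fixes t :: "real^'n \<Rightarrow> real"
  assumes t_smooth: "smooth_on S t"
begin

lemma differential_smooth: "smooth_vec S (differential t)"
  by (simp add: smooth_vec_def differential_def smooth_on_pd t_smooth)

lemma vpd_differential: "vpd i (differential t) x
    = hessian g t x $ i + transpose (Gam i x) *v differential t x"
  by (simp add: vec_eq_iff vpd_def differential_def hessian_def Gam_def matrix_vector_mult_def
      transpose_def)

lemma hessian_sym:
  assumes "x \<in> S"
  shows "transpose (hessian g t x) = hessian g t x"
  using christoffel_sym[OF assms] pd_commute[OF S_open t_smooth assms]
  by (simp add: vec_eq_iff transpose_def hessian_def)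

text \<open>Since \<open>J\<close> is parallel, the covariant derivative of the 1-form
  \<open>?\<theta>\<close> is the Hessian composed with \<open>J\<close>. Antisymmetrising removes
  the Christoffel terms and shows that the 2-form is half the exterior derivative of
  \<open>?\<theta>\<close>, hence closed.\<close>

lemma hessian_form_closed:
  assumes "x \<in> S" and inv: "\<And>y. y \<in> S \<Longrightarrow> transpose (J y) ** hessian g t y ** J y = hessian g t y"
  shows "ext_deriv (\<lambda>y. hessian g t y ** J y) k i j x = 0"
proof -
  let ?\<theta> = "\<lambda>y. transpose (J y) *v differential t y"
  have smooth: "smooth_vec S ?\<theta>"
    by (intro smooth_intros S_open J_smooth differential_smooth)
  have \<theta>: "vpd i ?\<theta> y = transpose (Gam i y) *v ?\<theta> y + transpose (J y) *v (hessian g t y $ i)"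
      if "y \<in> S" for i y
  proof -
    have "vpd i ?\<theta> y = transpose (mpd i J y) *v differential t y
        + transpose (J y) *v vpd i (differential t) y"
      using vpd_mult[OF that smooth_mat_transpose[OF J_smooth] differential_smooth]
      by (simp add: mpd_transpose)
    then show ?thesis
      by (simp add: mpd_J[OF that] vpd_differential matrix_ring_simps matrix_vector_mul_assoc
          algebra_simps)
  qed
  have 1: "(transpose (J y) *v (hessian g t y $ i)) $ j = (hessian g t y ** J y) $ i $ j" for i j y
    by (simp add: matrix_vector_mult_def transpose_def matrix_matrix_mult_def mult.commute)
  have 2: "(transpose (Gam i y) *v z) $ j = (transpose (Gam j y) *v z) $ i" if "y \<in> S" for i j y z
    using christoffel_sym[OF that, of _ i j] by (simp add: matrix_vector_mult_def transpose_def Gam_def)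
  have anti: "(hessian g t y ** J y) $ i $ j = - (hessian g t y ** J y) $ j $ i" if "y \<in> S" for i j y
    by (rule antisym_matrix_nth, unfold matrix_transpose_mul hessian_sym[OF that])
      (rule J_anti_invariant[OF that inv[OF that]])
  have b: "(hessian g t y ** J y) $ i $ j
      = (1 / 2) * (pd i (\<lambda>y. ?\<theta> y $ j) y - pd j (\<lambda>y. ?\<theta> y $ i) y)" if "y \<in> S" for i j y
  proof -
    have "pd i (\<lambda>y. ?\<theta> y $ j) y - pd j (\<lambda>y. ?\<theta> y $ i) y = vpd i ?\<theta> y $ j - vpd j ?\<theta> y $ i"
      by (simp add: vpd_def)
    also have "\<dots> = (hessian g t y ** J y) $ i $ j - (hessian g t y ** J y) $ j $ i"
      using 2[OF that, of i "?\<theta> y" j] by (simp only: \<theta>[OF that] vector_add_component 1)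
    finally show ?thesis using anti[OF that, of i j] by simp
  qed
  have d: "pd i (\<lambda>y. ?\<theta> y $ j) differentiable at x" for i j
    by (intro smooth_on_differentiable[OF smooth_on_pd assms(1)] smooth_vec_D smooth)
  have m: "mpd k (\<lambda>y. hessian g t y ** J y) x $ i $ j
      = (1 / 2) * (pd k (pd i (\<lambda>y. ?\<theta> y $ j)) x - pd k (pd j (\<lambda>y. ?\<theta> y $ i)) x)" for i j k
  proof -
    have "mpd k (\<lambda>y. hessian g t y ** J y) x $ i $ j
        = pd k (\<lambda>y. (1 / 2) * (pd i (\<lambda>y. ?\<theta> y $ j) y - pd j (\<lambda>y. ?\<theta> y $ i) y)) x"
      unfolding mpd_def by (simp only: vec_lambda_beta, rule pd_cong[OF S_open assms(1)]) (rule b)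
    also have "\<dots> = (1 / 2) * pd k (\<lambda>y. pd i (\<lambda>y. ?\<theta> y $ j) y - pd j (\<lambda>y. ?\<theta> y $ i) y) x"
      by (subst pd_mult) (auto simp: pd_const d)
    also have "pd k (\<lambda>y. pd i (\<lambda>y. ?\<theta> y $ j) y - pd j (\<lambda>y. ?\<theta> y $ i) y) x
        = pd k (pd i (\<lambda>y. ?\<theta> y $ j)) x - pd k (pd j (\<lambda>y. ?\<theta> y $ i)) x"
      by (subst pd_diff) (auto simp: d)
    finally show ?thesis .
  qed
  have c: "pd a (pd b (\<lambda>y. ?\<theta> y $ c)) x = pd b (pd a (\<lambda>y. ?\<theta> y $ c)) x" for a b c
    by (rule pd_commute[OF S_open smooth_vec_D[OF smooth] assms(1)])
  show ?thesis unfolding ext_deriv_def m using c[of k i j] c[of k j i] c[of i j k] by argo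
qed

lemma gradient_smooth: "smooth_vec S (gradient g t)"
  unfolding gradient_def[abs_def] by (intro smooth_intros S_open g_inv_smooth differential_smooth)

lemma g_gradient: "x \<in> S \<Longrightarrow> g x *v gradient g t x = differential t x"
  by (simp add: gradient_def matrix_vector_mul_assoc g_inverse)

text \<open>Differentiate \<open>g_gradient\<close>: the part of \<open>mpd_g\<close> with the
  transposed connection matrix cancels the Christoffel term in the derivative of the
  differential.\<close>

lemma g_nabla_gradient:
  assumes "x \<in> S"
  shows "g x *v (vpd i (gradient g t) x + Gam i x *v gradient g t x) = hessian g t x $ i"
proof -
  have "vpd i (\<lambda>y. g y *v gradient g t y) x = vpd i (differential t) x"
    by (rule vpd_cong[OF S_open assms]) (rule g_gradient)
  then have "mpd i g x *v gradient g t x + g x *v vpd i (gradient g t) x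
      = hessian g t x $ i + transpose (Gam i x) *v (g x *v gradient g t x)"
    by (simp add: vpd_mult[OF assms g_smooth gradient_smooth] vpd_differential g_gradient[OF assms])
  then show ?thesis
    by (simp add: mpd_g[OF assms] matrix_vector_mult_add_rdistrib matrix_vector_right_distrib
        matrix_vector_mul_assoc algebra_simps)
qed

lemma nabla_gradient:
  assumes "x \<in> S"
  shows "vpd i (gradient g t) x + Gam i x *v gradient g t x = matrix_inv (g x) *v (hessian g t x $ i)"
  by (simp add: g_nabla_gradient[OF assms, symmetric] matrix_vector_mul_assoc g_inverse[OF assms])

text \<open>For a torsion-free connection the Lie derivative of \<open>J\<close> is its covariant
  derivative along the gradient minus the commutator of the Hessian endomorphism \<open>H\<close>
  with \<open>J\<close>. The first vanishes because \<open>J\<close> is parallel, the second because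
  the Hessian is \<open>J\<close>-invariant.\<close>

lemma lie_deriv_gradient:
  assumes "x \<in> S" and inv: "transpose (J x) ** hessian g t x ** J x = hessian g t x"
  shows "lie_deriv_endo (gradient g t) J x = 0"
proof -
  let ?v = "gradient g t x" and ?h = "hessian g t x" and ?G = "\<chi> i j. (Gam j x *v gradient g t x) $ i"
  define H where "H = matrix_inv (g x) ** ?h"
  have dv: "pd k (\<lambda>y. gradient g t y $ i) x = H $ i $ k - ?G $ i $ k" for i k
  proof -
    have "(matrix_inv (g x) *v (?h $ k)) $ i = H $ i $ k"
      using sym_matrix_nth[OF hessian_sym[OF assms(1)], of k]
      by (simp add: H_def matrix_vector_mult_def matrix_matrix_mult_def)
    moreover have "vpd k (gradient g t) x $ i + (Gam k x *v ?v) $ i = (matrix_inv (g x) *v (?h $ k)) $ i"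
      using nabla_gradient[OF assms(1), of k] by (metis vector_add_component)
    ultimately show ?thesis by (simp add: vpd_def)
  qed
  \<comment> \<open>Absence of torsion identifies the Christoffel part of the derivative of the
    gradient with the connection matrix along the gradient, so the two contributions cancel at the
    end.\<close>
  have G: "(\<Sum>k\<in>UNIV. ?v $ k *\<^sub>R Gam k x) = ?G"
    using christoffel_sym[OF assms(1)]
    by (simp add: vec_eq_iff Gam_def matrix_vector_mult_def mult.commute)
  have "H ** J x = J x ** H"
  proof -
    have "H ** J x = - (matrix_inv (g x) ** transpose (J x) ** ?h)"
      by (simp add: H_def matrix_mul_assoc[symmetric] J_anti_invariant[OF assms] matrix_minus_right)
    also have "matrix_inv (g x) ** transpose (J x)
        = matrix_inv (g x) ** (transpose (J x) ** g x) ** matrix_inv (g x)"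
      by (simp add: matrix_mul_assoc[symmetric] g_inverse[OF assms(1)])
    also have "transpose (J x) ** g x = - (g x ** J x)"
      using J_anti_invariant[OF assms(1) cplx_orth[OF assms(1)]] by simp
    also have "matrix_inv (g x) ** - (g x ** J x) ** matrix_inv (g x) = - (J x ** matrix_inv (g x))"
      by (simp add: matrix_minus_right matrix_minus_left matrix_mul_assoc g_inverse[OF assms(1)])
    finally show ?thesis by (simp add: H_def matrix_minus_left matrix_mul_assoc)
  qed
  moreover have "lie_deriv_endo (gradient g t) J x
    = (\<Sum>k\<in>UNIV. ?v $ k *\<^sub>R mpd k J x) - (H - ?G) ** J x + J x ** (H - ?G)"
    by (simp add: lie_deriv_endo_def vec_eq_iff mpd_def dv matrix_matrix_mult_def sum.distrib
        sum_subtractf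
        left_diff_distrib right_diff_distrib mult.commute)
  moreover have "(\<Sum>k\<in>UNIV. ?v $ k *\<^sub>R mpd k J x) = J x ** ?G - ?G ** J x"
    unfolding G[symmetric] matrix_mult_sum_left matrix_mult_sum_right matrix_mult_scaleR
    by (simp add: mpd_J[OF assms(1)] scaleR_diff_right sum_subtractf)
  ultimately show ?thesis by (simp add: matrix_ring_simps)
qed

text \<open>\<open>gradient_sq\<close> is the differential applied to the gradient; covariantly,
  each of the two factors contributes the same Hessian term.\<close>

lemma differential_gradient_sq:
  assumes "x \<in> S"
  shows "differential (gradient_sq g t) x = 2 *\<^sub>R (hessian g t x *v gradient g t x)"
proof -
  let ?v = "gradient g t x" and ?h = "hessian g t x"
  have "pd k (gradient_sq g t) x = 2 * (?h *v ?v) $ k" for k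
  proof -
    have "pd k (gradient_sq g t) x = pd k (\<lambda>y. gradient g t y \<bullet> differential t y) x"
      by (rule pd_cong[OF S_open assms]) (simp add: gradient_sq_def g_gradient)
    also have "\<dots> = vpd k (gradient g t) x \<bullet> differential t x + ?v \<bullet> vpd k (differential t) x"
      by (rule pd_inner[OF assms gradient_smooth differential_smooth])
    also have "\<dots> = vpd k (gradient g t) x \<bullet> (g x *v ?v) + ?v \<bullet> (?h $ k) + (Gam k x *v ?v) \<bullet> (g x *v ?v)"
      by (simp add: vpd_differential g_gradient[OF assms] inner_add_right dot_matrix_transpose)
    also have "\<dots> = (vpd k (gradient g t) x + Gam k x *v ?v) \<bullet> (g x *v ?v) + ?v \<bullet> (?h $ k)"
      by (simp add: inner_add_left)
    also have "(vpd k (gradient g t) x + Gam k x *v ?v) \<bullet> (g x *v ?v) = ?v \<bullet> (?h $ k)"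
      using g_nabla_gradient[OF assms, of k] metric_sym[OF assms]
      by (metis dot_matrix_transpose inner_commute)
    finally show ?thesis by (simp add: matrix_vector_mul_component inner_commute)
  qed
  then show ?thesis by (simp add: vec_eq_iff differential_def)
qed

end

end

subsection \<open>The Ricci-Hessian equation\<close>

context kahler_coords
begin

lemma hermitian: "x \<in> S \<Longrightarrow> hermitian_space (g x) (J x)"
  by unfold_locales (simp_all add: metric_sym metric_pos cplx_sq cplx_orth)

context
  fixes t s a :: "real^'n \<Rightarrow> real" and F :: "real \<Rightarrow> real" and I :: "real set"
  assumes t_smooth: "smooth_on S t" and s_smooth: "smooth_on S s"
    and F: "open I" "smooth_on I F"
    and a_eq: "\<And>y. y \<in> S \<Longrightarrow> t y \<in> I \<and> a y = F (t y)"
    and ricci_hessian: "\<And>y. y \<in> S \<Longrightarrow> a y *\<^sub>R hessian g t y + ricci g y = s y *\<^sub>R g y"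
    and nonzero: "\<And>y. y \<in> S \<Longrightarrow> a y *\<^sub>R differential a y \<noteq> 0 \<and> differential t y \<noteq> 0"
begin

lemma potential_hessian_J_invariant:
  assumes "x \<in> S"
  shows "transpose (J x) ** hessian g t x ** J x = hessian g t x"
proof -
  have "a x *\<^sub>R hessian g t x = s x *\<^sub>R g x - ricci g x"
    using ricci_hessian[OF assms] by (simp add: algebra_simps)
  moreover have "transpose (J x) ** (s x *\<^sub>R g x - ricci g x) ** J x = s x *\<^sub>R g x - ricci g x"
    using cplx_orth[OF assms] ricci_J_invariant[OF assms]
    by (simp add: matrix_diff_ldistrib matrix_diff_rdistrib matrix_mult_scaleR)
  ultimately have "a x *\<^sub>R (transpose (J x) ** hessian g t x ** J x) = a x *\<^sub>R hessian g t x"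
    by (metis matrix_mult_scaleR)
  then show ?thesis using nonzero[OF assms] by auto
qed

text \<open>Symmetry is read off from the equation, whose other two terms are symmetric.\<close>

lemma potential_ricci_sym:
  assumes "x \<in> S"
  shows "transpose (ricci g x) = ricci g x"
proof -
  have "ricci g x = s x *\<^sub>R g x - a x *\<^sub>R hessian g t x"
    using ricci_hessian[OF assms] by (simp add: algebra_simps)
  then show ?thesis
    by (simp add: transpose_diff transpose_scaleR metric_sym[OF assms] hessian_sym[OF t_smooth assms])
qed

text \<open>The chain rule for \<open>F\<close> composed with \<open>t\<close>, transferred to
  \<open>a\<close>, which agrees with this composite on the open set \<open>S\<close>.\<close>

lemma coefficient_has_derivative:
  assumes "x \<in> S"
  shows "a differentiable at x" "\<exists>c. differential a x = c *\<^sub>R differential t x"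
proof -
  have "(F has_derivative frechet_derivative F (at (t x))) (at (t x))"
    using smooth_on_differentiable[OF F(2)] a_eq[OF assms] frechet_derivative_works by blast
  moreover have "(t has_derivative frechet_derivative t (at x)) (at x)"
    using smooth_on_differentiable[OF t_smooth assms] frechet_derivative_works by blast
  ultimately have "((\<lambda>y. F (t y)) has_derivative
      (\<lambda>u. frechet_derivative F (at (t x)) (frechet_derivative t (at x) u))) (at x)"
    by (rule has_derivative_compose[rotated])
  then have d: "(a has_derivative
      (\<lambda>u. frechet_derivative F (at (t x)) (frechet_derivative t (at x) u))) (at x)"
    by (rule has_derivative_transform_within_open[OF _ S_open assms]) (simp add: a_eq)
  then show "a differentiable at x" by (rule differentiableI)
  have "linear (frechet_derivative F (at (t x)))"
    using smooth_on_differentiable[OF F(2)] a_eq[OF assms] linear_frechet_derivative by blast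
  then have r: "frechet_derivative F (at (t x)) r = frechet_derivative F (at (t x)) 1 * r" for r
    using linear_cmul[of "frechet_derivative F (at (t x))" r 1] by (simp add: mult.commute)
  have "differential a x $ i = (frechet_derivative F (at (t x)) 1 *\<^sub>R differential t x) $ i" for i
    using r[of "frechet_derivative t (at x) (axis i 1)"]
    by (simp add: differential_def pd_def frechet_derivative_at[OF d, symmetric])
  then have "differential a x = frechet_derivative F (at (t x)) 1 *\<^sub>R differential t x"
    by (simp only: vec_eq_iff simp_thms)
  then show "\<exists>c. differential a x = c *\<^sub>R differential t x" by blast
qed

text \<open>Compose the equation with \<open>J\<close> and take exterior derivatives: all three
  2-forms are closed, so only the differentials of the coefficients survive.\<close>

lemma wedge12_ricci_hessian:
  assumes "x \<in> S"
  shows "wedge12 (differential a x) (hessian g t x ** J x) k i j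
      = wedge12 (differential s x) (g x ** J x) k i j"
proof -
  note Js = S_open J_smooth
  have h_smooth: "smooth_mat S (hessian g t)"
    unfolding smooth_mat_def hessian_def
    by (auto intro!: smooth_on_diff smooth_on_sum smooth_on_mult smooth_on_pd t_smooth S_open
        christoffel_smooth)
  have r_smooth: "smooth_mat S (ricci g)"
    unfolding smooth_mat_def ricci_def riemann_def
    by (auto intro!: smooth_on_diff smooth_on_sum smooth_on_add smooth_on_mult smooth_on_pd S_open
        christoffel_smooth)
  \<comment> \<open>Only differentiability of \<open>a\<close> has been established, so smoothness
    of this product comes from the other two terms of the equation.\<close>
  have a_smooth: "smooth_mat S (\<lambda>y. a y *\<^sub>R (hessian g t y ** J y))"
  proof (rule smooth_mat_cong[OF S_open])
    fix y assume "y \<in> S"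
    then have "a y *\<^sub>R hessian g t y = s y *\<^sub>R g y - ricci g y"
      using ricci_hessian by (simp add: algebra_simps)
    then show "s y *\<^sub>R (g y ** J y) - ricci g y ** J y = a y *\<^sub>R (hessian g t y ** J y)"
      by (metis matrix_diff_rdistrib matrix_mult_scaleR(2))
  next
    have "smooth_mat S (\<lambda>y. s y *\<^sub>R (g y ** J y))"
      using smooth_mat_mult[OF S_open g_smooth J_smooth]
      by (auto simp: smooth_mat_def intro!: smooth_on_mult S_open s_smooth)
    then show "smooth_mat S (\<lambda>y. s y *\<^sub>R (g y ** J y) - ricci g y ** J y)"
      by (intro smooth_intros Js r_smooth)
  qed
  have "ext_deriv (\<lambda>y. a y *\<^sub>R (hessian g t y ** J y) + ricci g y ** J y) k i j x
      = ext_deriv (\<lambda>y. s y *\<^sub>R (g y ** J y)) k i j x"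
  proof (rule ext_deriv_cong[OF S_open assms])
    fix y assume "y \<in> S"
    from ricci_hessian[OF this]
    show "a y *\<^sub>R (hessian g t y ** J y) + ricci g y ** J y = s y *\<^sub>R (g y ** J y)"
      by (metis matrix_add_rdistrib matrix_mult_scaleR(2))
  qed
  moreover have "ext_deriv (\<lambda>y. a y *\<^sub>R (hessian g t y ** J y) + ricci g y ** J y) k i j x
      = ext_deriv (\<lambda>y. a y *\<^sub>R (hessian g t y ** J y)) k i j x"
    using ricci_form_closed[OF assms potential_ricci_sym]
    by (subst ext_deriv_add[OF assms a_smooth smooth_mat_mult[OF S_open r_smooth J_smooth]]) simp
  moreover have "\<dots> = wedge12 (differential a x) (hessian g t x ** J x) k i j"
    using hessian_form_closed[OF t_smooth assms potential_hessian_J_invariant]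
    by (subst ext_deriv_scaleR[OF assms smooth_mat_mult[OF S_open h_smooth J_smooth]
          coefficient_has_derivative(1)[OF assms]]) simp
  moreover have "ext_deriv (\<lambda>y. s y *\<^sub>R (g y ** J y)) k i j x
      = wedge12 (differential s x) (g x ** J x) k i j"
    using kahler_form_closed[OF assms]
    by (subst ext_deriv_scaleR[OF assms smooth_mat_mult[OF S_open g_smooth J_smooth]
          smooth_on_differentiable[OF s_smooth assms]]) simp
  ultimately show ?thesis by simp
qed

lemma potential_hessian_eigenvector:
  assumes x: "x \<in> S" and n: "CARD('n) \<ge> 4"
    and cases: "CARD('n) > 4 \<or> CARD('n) = 4 \<and> wedge (differential s x) (differential t x) = 0
      \<or> wedge (differential (gradient_sq g t) x) (differential t x) = 0"
    and w: "w \<noteq> 0" "w \<bullet> (g x *v gradient g t x) = 0" "w \<bullet> (g x *v (J x *v gradient g t x)) = 0"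
  shows "\<exists>l. hessian g t x *v w = l *\<^sub>R (g x *v w)"
proof -
  interpret hermitian_space "g x" "J x" by (rule hermitian[OF x])
  note v = g_gradient[OF t_smooth x] conjunct2[OF nonzero[OF x]]
  note h = potential_hessian_J_invariant[OF x]
  obtain c where c: "differential a x = c *\<^sub>R differential t x"
    using coefficient_has_derivative(2)[OF x] by blast
  then have "c \<noteq> 0" using nonzero[OF x] by auto
  have A: ?thesis if "differential s x = \<mu> *\<^sub>R differential t x" for \<mu>
    using eigenvector_if_wedge12[OF v c \<open>c \<noteq> 0\<close> that h wedge12_ricci_hessian[OF x] w(2,3)] by blast
  \<comment> \<open>Above dimension 4 the first case applies whatever else is assumed, so the
    condition on Q is needed only in dimension 4.\<close>
  consider "CARD('n) > 4" | "wedge (differential s x) (differential t x) = 0"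
    | "CARD('n) = 4" "wedge (differential (gradient_sq g t) x) (differential t x) = 0"
    using cases n by linarith
  then show ?thesis
  proof cases
    case 1
    then show ?thesis using parallel_if_wedge12[OF 1 v c wedge12_ricci_hessian[OF x]] A by blast
  next
    case 2
    then show ?thesis using parallel_if_wedge_zero[OF 2 v(2)] A by blast
  next
    case 3
    then obtain \<mu> where "2 *\<^sub>R (hessian g t x *v gradient g t x) = \<mu> *\<^sub>R differential t x"
      using parallel_if_wedge_zero[OF 3(2) v(2)] differential_gradient_sq[OF t_smooth x] by auto
    then have "(1 / 2) *\<^sub>R (2 *\<^sub>R (hessian g t x *v gradient g t x)) = (1 / 2) *\<^sub>R \<mu> *\<^sub>R differential t x"
      by simp
    then have "hessian g t x *v gradient g t x = (\<mu> / 2) *\<^sub>R (g x *v gradient g t x)"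
      by (simp add: v(1))
    moreover have "gradient g t x \<noteq> 0" using v by auto
    ultimately show ?thesis
      using eigenvector_dim4[OF 3(1) _ _ h hessian_sym[OF t_smooth x] w] by blast
  qed
qed

text \<open>The equation expresses the Ricci tensor through the metric and the Hessian, so an
  eigenvalue \<open>l\<close> of the Hessian gives the Ricci eigenvalue
  \<open>s x - a x * l\<close>.\<close>

lemma potential_eigenvectors:
  assumes x: "x \<in> S" and n: "CARD('n) \<ge> 4"
    and cases: "CARD('n) > 4 \<or> CARD('n) = 4 \<and> wedge (differential s x) (differential t x) = 0
      \<or> wedge (differential (gradient_sq g t) x) (differential t x) = 0"
    and w: "w \<noteq> 0" "w \<bullet> (g x *v gradient g t x) = 0" "w \<bullet> (g x *v (J x *v gradient g t x)) = 0"
  shows "is_eigenvector (as_endo (g x) (hessian g t x)) w" "is_eigenvector (as_endo (g x) (ricci g x)) w"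
proof -
  have eig: "is_eigenvector (as_endo (g x) B) w" if "B *v w = l *\<^sub>R (g x *v w)" for B l
  proof -
    have "as_endo (g x) B *v w = l *\<^sub>R ((matrix_inv (g x) ** g x) *v w)"
      by (simp add: as_endo_def matrix_vector_mul_assoc[symmetric] that matrix_vector_mult_scaleR)
    then show ?thesis using w(1) by (auto simp: is_eigenvector_def g_inverse[OF x])
  qed
  obtain l where l: "hessian g t x *v w = l *\<^sub>R (g x *v w)"
    using potential_hessian_eigenvector[OF assms] by blast
  then show "is_eigenvector (as_endo (g x) (hessian g t x)) w" by (rule eig)
  have "ricci g x = s x *\<^sub>R g x - a x *\<^sub>R hessian g t x"
    using ricci_hessian[OF x] by (simp add: algebra_simps)
  then have "ricci g x *v w = (s x - a x * l) *\<^sub>R (g x *v w)"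
    by (simp add: matrix_vector_mult_diff_rdistrib scaleR_matrix_vector_assoc[symmetric] l
        scaleR_diff_left)
  then show "is_eigenvector (as_endo (g x) (ricci g x)) w" by (rule eig)
qed

end

end

subsection \<open>Open submanifolds\<close>

lemma open_submanifold_simps [simp]:
  "mtop (open_submanifold M U) = subtopology (mtop M) U"
  "atlas (open_submanifold M U) = {c \<in> atlas M. cdom c \<subseteq> U}"
  "metric (open_submanifold M U) = metric M" "cplx (open_submanifold M U) = cplx M"
  by (simp_all add: open_submanifold_def)

lemma cinv_cimage:
  assumes "x \<in> cimage c"
  shows "cinv c x \<in> cdom c" "coord c (cinv c x) = x"
  using assms unfolding cinv_def by (simp_all add: inv_into_into f_inv_into_f)

lemma chart_cdom_subset: "is_chart X c \<Longrightarrow> cdom c \<subseteq> topspace X"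
  by (simp add: is_chart_def openin_subset)

lemma chart_inj:
  assumes "is_chart X c"
  shows "inj_on (coord c) (cdom c)"
proof -
  have "inj_on (coord c) (topspace (subtopology X (cdom c)))"
    using assms unfolding is_chart_def by (intro homeomorphic_imp_injective_map) blast
  then show ?thesis using chart_cdom_subset[OF assms] by (simp add: inf_absorb2)
qed

lemma chart_image_open:
  assumes "is_chart X c" "openin X V" "V \<subseteq> cdom c"
  shows "open (coord c ` V)"
proof -
  have "openin (subtopology X (cdom c)) V"
    using assms by (simp add: openin_open_subtopology is_chart_def)
  then have "openin (top_of_set (cimage c)) (coord c ` V)"
    using assms(1) homeomorphic_imp_open_map unfolding is_chart_def open_map_def by blast
  then show ?thesis
    using assms(1) openin_open_trans unfolding is_chart_def by blast
qed

lemma is_chart_subtopology: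
  assumes "openin X U"
  shows "is_chart (subtopology X U) c \<longleftrightarrow> is_chart X c \<and> cdom c \<subseteq> U"
proof -
  have "subtopology (subtopology X U) (cdom c) = subtopology X (cdom c)" if "cdom c \<subseteq> U"
    using that by (simp add: subtopology_subtopology inf_absorb2)
  then show ?thesis
    unfolding is_chart_def using openin_open_subtopology[OF assms] by auto
qed

text \<open>The coordinate map is kept and only the domain shrinks, so transition maps change only
  through the choice made by \<open>cinv\<close>.\<close>

definition restrict_chart :: "'a set \<Rightarrow> ('a, 'n::finite) chart \<Rightarrow> ('a, 'n) chart" where
  "restrict_chart U c = (cdom c \<inter> U, coord c)"

lemma restrict_chart_simps [simp]:
  "cdom (restrict_chart U c) = cdom c \<inter> U" "coord (restrict_chart U c) = coord c"
  by (simp_all add: restrict_chart_def)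

lemma is_chart_restrict:
  assumes c: "is_chart X c" and U: "openin X U"
  shows "is_chart X (restrict_chart U c)"
proof -
  have o: "openin X (cdom c \<inter> U)" using c U by (auto simp: is_chart_def)
  have "homeomorphic_map (subtopology (subtopology X (cdom c)) U)
      (subtopology (top_of_set (cimage c)) (coord c ` (cdom c \<inter> U))) (coord c)"
  proof (rule homeomorphic_map_subtopologies)
    show "homeomorphic_map (subtopology X (cdom c)) (top_of_set (cimage c)) (coord c)"
      using c by (simp add: is_chart_def)
    show "coord c ` (topspace (subtopology X (cdom c)) \<inter> U)
        = topspace (top_of_set (cimage c)) \<inter> coord c ` (cdom c \<inter> U)"
      using chart_cdom_subset[OF c] by auto
  qed
  moreover have "cimage c \<inter> coord c ` (cdom c \<inter> U) = coord c ` (cdom c \<inter> U)" by auto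
  ultimately show ?thesis
    using o chart_image_open[OF c o] by (simp add: is_chart_def subtopology_subtopology)
qed

lemma transition_restrict_left:
  assumes "is_chart X c" "x \<in> coord c ` (cdom c \<inter> U)"
  shows "transition (restrict_chart U c) d x = transition c d x"
proof -
  obtain p where "p \<in> cdom c" "p \<in> U" "x = coord c p" using assms(2) by auto
  then have "cinv (restrict_chart U c) x = p" "cinv c x = p"
    using chart_inj[OF assms(1)] inj_on_subset[OF chart_inj[OF assms(1)], of "cdom c \<inter> U"]
    by (auto simp: cinv_def intro!: inv_into_f_f)
  then show ?thesis by (simp add: transition_def)
qed

lemma transition_restrict_right [simp]: "transition d (restrict_chart U c) = transition d c"
  by (simp add: transition_def)

lemma overlap_open:
  assumes "is_chart X c" "is_chart X d"
  shows "open (overlap c d)"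
  unfolding overlap_def using assms by (intro chart_image_open[OF assms(1)]) (auto simp: is_chart_def)

lemma compatible_restrict:
  assumes c: "is_chart X c" and d: "is_chart X d" and U: "openin X U" and cd: "compatible c d"
  shows "compatible (restrict_chart U c) d"
proof -
  have 1: "overlap (restrict_chart U c) d \<subseteq> overlap c d" "overlap d (restrict_chart U c) \<subseteq> overlap d c"
    by (auto simp: overlap_def)
  have "smooth_on (overlap (restrict_chart U c) d) (transition c d)"
    using cd 1 smooth_on_subset unfolding compatible_def by blast
  then have "smooth_on (overlap (restrict_chart U c) d) (transition (restrict_chart U c) d)"
    by (rule smooth_on_cong[OF overlap_open[OF is_chart_restrict[OF c U] d], rotated])
      (auto simp: overlap_def intro!: transition_restrict_left[OF c, symmetric])
  moreover have "smooth_on (overlap d (restrict_chart U c)) (transition d (restrict_chart U c))"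
    using cd 1 smooth_on_subset unfolding compatible_def by auto
  ultimately show ?thesis by (simp add: compatible_def)
qed

text \<open>As \<open>c\<close> lives inside \<open>U\<close>, its overlap with \<open>d\<close> is
  unaffected by cutting \<open>d\<close> down to \<open>U\<close>. This gives maximality of the
  atlas of \<open>U\<close>.\<close>

lemma compatible_unrestrict:
  assumes c: "is_chart X c" and d: "is_chart X d" and U: "openin X U" "cdom c \<subseteq> U"
    and cd: "compatible c (restrict_chart U d)"
  shows "compatible c d"
proof -
  have o: "overlap c (restrict_chart U d) = overlap c d" "overlap (restrict_chart U d) c = overlap d c"
    using U(2) by (auto simp: overlap_def intro!: image_cong)
  have "smooth_on (overlap d c) (transition (restrict_chart U d) c)"
    using cd o by (simp add: compatible_def)
  then have "smooth_on (overlap d c) (transition d c)"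
    by (rule smooth_on_cong[OF overlap_open[OF d c], rotated])
      (use U(2) in \<open>auto simp: overlap_def intro!: transition_restrict_left[OF d]\<close>)
  then show ?thesis using cd o by (simp add: compatible_def)
qed

lemma smooth_structure_restrict:
  assumes A: "smooth_structure X A" and c: "c \<in> A" and U: "openin X U"
  shows "restrict_chart U c \<in> A"
proof -
  have ch: "is_chart X d" if "d \<in> A" for d using A that by (simp add: smooth_structure_def)
  have "\<forall>d\<in>A. compatible (restrict_chart U c) d"
    using A c by (intro ballI compatible_restrict[OF ch ch U]) (simp_all add: smooth_structure_def)
  moreover have "\<And>c. is_chart X c \<and> (\<forall>d\<in>A. compatible c d) \<Longrightarrow> c \<in> A"
    using A unfolding smooth_structure_def by blast
  ultimately show ?thesis using is_chart_restrict[OF ch[OF c] U] by blast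
qed

text \<open>Restricted charts belong to the maximal atlas and cover \<open>U\<close>. A chart of
  \<open>U\<close> compatible with them is compatible with the unrestricted charts too, so
  maximality is inherited.\<close>

lemma smooth_structure_subtopology:
  assumes A: "smooth_structure X A" and U: "openin X U"
  shows "smooth_structure (subtopology X U) {c \<in> A. cdom c \<subseteq> U}"
  unfolding smooth_structure_def
proof (intro conjI allI impI ballI)
  have ch: "is_chart X c" if "c \<in> A" for c using A that by (simp add: smooth_structure_def)
  show "is_chart (subtopology X U) c" if "c \<in> {c \<in> A. cdom c \<subseteq> U}" for c
    using that ch by (simp add: is_chart_subtopology[OF U])
  show "\<Union> (cdom ` {c \<in> A. cdom c \<subseteq> U}) = topspace (subtopology X U)"
  proof
    show "topspace (subtopology X U) \<subseteq> \<Union> (cdom ` {c \<in> A. cdom c \<subseteq> U})"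
    proof
      fix p assume "p \<in> topspace (subtopology X U)"
      then have p: "p \<in> topspace X" "p \<in> U" by auto
      then obtain c where "c \<in> A" "p \<in> cdom c" using A unfolding smooth_structure_def by blast
      then show "p \<in> \<Union> (cdom ` {c \<in> A. cdom c \<subseteq> U})"
        using p smooth_structure_restrict[OF A _ U] by (intro UN_I[of "restrict_chart U c"]) auto
    qed
  qed (use ch chart_cdom_subset in fastforce)
  show "compatible c d" if "c \<in> {c \<in> A. cdom c \<subseteq> U}" "d \<in> {c \<in> A. cdom c \<subseteq> U}" for c d
    using that A by (simp add: smooth_structure_def)
  show "c \<in> {c \<in> A. cdom c \<subseteq> U}"
    if c: "is_chart (subtopology X U) c \<and> (\<forall>d\<in>{c \<in> A. cdom c \<subseteq> U}. compatible c d)" for c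
  proof -
    have cU: "is_chart X c" "cdom c \<subseteq> U" using c by (simp_all add: is_chart_subtopology[OF U])
    have "compatible c d" if "d \<in> A" for d
      using smooth_structure_restrict[OF A that U]
      by (intro compatible_unrestrict[OF cU(1) ch[OF that] U cU(2)] bspec[OF conjunct2[OF c]]) simp
    then show ?thesis using A cU unfolding smooth_structure_def by blast
  qed
qed

lemma kahler_manifold_open_submanifold:
  assumes M: "kahler_manifold M" and U: "openin (mtop M) U" "U \<noteq> {}" "connectedin (mtop M) U"
  shows "kahler_manifold (open_submanifold M U)"
proof -
  have "smooth_manifold (subtopology (mtop M) U) {c \<in> atlas M. cdom c \<subseteq> U}"
    using M U openin_subset[OF U(1)] smooth_structure_subtopology[OF _ U(1)]
    unfolding kahler_manifold_def smooth_manifold_def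
    by (auto simp: Hausdorff_space_subtopology second_countable_subtopology connectedin_def)
  then show ?thesis
    using M unfolding kahler_manifold_def riemannian_metric_def endo_field_def by auto
qed

lemma kahler_coords_chart:
  assumes M: "kahler_manifold M" and c: "c \<in> atlas M"
  shows "kahler_coords (cimage c) (metric M c) (cplx M c)"
  using assms
  unfolding kahler_coords_def kahler_manifold_def smooth_manifold_def smooth_structure_def is_chart_def
    riemannian_metric_def endo_field_def
  by (intro conjI allI impI) blast+

section \<open>From coordinate identities to the manifold\<close>

theorem theoremB:
  fixes M :: "('a, 'n::finite) kahler_data"
    and \<tau> \<alpha> \<sigma> :: "'a \<Rightarrow> real"
    and U :: "'a set"
  assumes kahler: "kahler_manifold M"
    and dim: "CARD('n) \<ge> 4"
    and smooth: "smooth_fun M \<tau>" "smooth_fun M \<sigma>"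
    and alpha: "smooth_function_of M \<alpha> \<tau>"
    and ricci_hessian:
      "\<forall>p\<in>topspace (mtop M). \<forall>c\<in>charts_at M p.
         \<alpha> p *\<^sub>R hess_at M \<tau> c p + ricci_at M c p = \<sigma> p *\<^sub>R metric_at M c p"
    and dense:
      "mtop M closure_of {p \<in> topspace (mtop M). \<forall>c\<in>charts_at M p. \<alpha> p *\<^sub>R hess_at M \<tau> c p \<noteq> 0}
         = topspace (mtop M)"
    and U: "openin (mtop M) U" "U \<noteq> {}" "connectedin (mtop M) U"
    and nonzero:
      "\<forall>p\<in>U. \<forall>c\<in>charts_at M p. \<alpha> p *\<^sub>R diff_at \<alpha> c p \<noteq> 0 \<and> diff_at \<tau> c p \<noteq> 0"
    and cases:
      "CARD('n) > 4 \<or>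
       CARD('n) = 4 \<and> (\<forall>p\<in>U. \<forall>c\<in>charts_at M p. wedge (diff_at \<sigma> c p) (diff_at \<tau> c p) = 0) \<or>
       (\<forall>p\<in>U. \<forall>c\<in>charts_at M p. wedge (diff_gradsq_at M \<tau> c p) (diff_at \<tau> c p) = 0)"
  shows "special_kr_potential (open_submanifold M U) \<tau>"
proof -
  have struct: "smooth_structure (mtop M) (atlas M)"
    using kahler by (simp add: kahler_manifold_def smooth_manifold_def)
  have U_sub: "U \<subseteq> topspace (mtop M)" using U(1) by (rule openin_subset)
  have inv: "cinv c (coord c p) = p" if "c \<in> atlas M" "p \<in> cdom c" for c p
  proof -
    have "is_chart (mtop M) c" using struct that by (simp add: smooth_structure_def)
    then show ?thesis unfolding cinv_def using chart_inj that(2) inv_into_f_f by metis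
  qed
  obtain F I where F: "open I" "smooth_on I F" "\<And>p. p \<in> topspace (mtop M) \<Longrightarrow> \<tau> p \<in> I \<and> \<alpha> p = F (\<tau> p)"
    using alpha unfolding smooth_function_of_def by blast
  \<comment> \<open>Both conditions on the potential are local, so they are checked in each chart
    contained in \<open>U\<close>.\<close>
  have main: "lie_deriv_endo (gradient (metric M c) (local_rep c \<tau>)) (cplx M c) x = 0 \<and>
      (\<forall>w. w \<noteq> 0 \<and> w \<bullet> (metric M c x *v gradient (metric M c) (local_rep c \<tau>) x) = 0 \<and>
        w \<bullet> (metric M c x *v (cplx M c x *v gradient (metric M c) (local_rep c \<tau>) x)) = 0 \<longrightarrow>
        is_eigenvector (as_endo (metric M c x) (hessian (metric M c) (local_rep c \<tau>) x)) w \<and>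
        is_eigenvector (as_endo (metric M c x) (ricci (metric M c) x)) w)"
    if c: "c \<in> atlas M" "cdom c \<subseteq> U" and x: "x \<in> cimage c" for c x
  proof -
    interpret kahler_coords "cimage c" "metric M c" "cplx M c"
      by (rule kahler_coords_chart[OF kahler c(1)])
    have ts: "smooth_on (cimage c) (local_rep c \<tau>)" "smooth_on (cimage c) (local_rep c \<sigma>)"
      using smooth c(1) by (simp_all add: smooth_fun_def)
    have p: "cinv c y \<in> U" "cinv c y \<in> topspace (mtop M)" "c \<in> charts_at M (cinv c y)"
      "coord c (cinv c y) = y" if "y \<in> cimage c" for y
      using cinv_cimage[OF that] c U_sub by (auto simp: charts_at_def)
    have a: "local_rep c \<tau> y \<in> I \<and> local_rep c \<alpha> y = F (local_rep c \<tau> y)" if "y \<in> cimage c" for y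
      using F(3)[OF p(2)[OF that]] by (simp add: local_rep_def)
    have e: "local_rep c \<alpha> y *\<^sub>R hessian (metric M c) (local_rep c \<tau>) y + ricci (metric M c) y
        = local_rep c \<sigma> y *\<^sub>R metric M c y" if "y \<in> cimage c" for y
      using ricci_hessian p[OF that]
      by (fastforce simp: hess_at_def ricci_at_def metric_at_def local_rep_def)
    have nz: "local_rep c \<alpha> y *\<^sub>R differential (local_rep c \<alpha>) y \<noteq> 0 \<and> differential (local_rep c \<tau>) y \<noteq> 0"
      if "y \<in> cimage c" for y
      using bspec[OF bspec[OF nonzero p(1)[OF that]] p(3)[OF that]] p(4)[OF that]
      by (simp add: diff_at_def local_rep_def)
    have cs: "CARD('n) > 4 \<or>
        CARD('n) = 4 \<and> wedge (differential (local_rep c \<sigma>) x) (differential (local_rep c \<tau>) x) = 0 \<or>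
        wedge (differential (gradient_sq (metric M c) (local_rep c \<tau>)) x) (differential (local_rep
            c \<tau>) x) = 0"
      using cases p[OF x] unfolding diff_at_def diff_gradsq_at_def by metis
    note hyps = ts F(1,2) a e nz
    show ?thesis
      using lie_deriv_gradient[OF ts(1) x potential_hessian_J_invariant[OF hyps x]]
        potential_eigenvectors[OF hyps x dim cs] by blast
  qed
  \<comment> \<open>\<open>U\<close> is nonempty and d\<tau> has no zero there. The chart is first
    cut down to \<open>U\<close>, so that a constant \<tau> would be constant on its entire
    domain.\<close>
  have "\<not> \<tau> constant_on U"
  proof
    assume const: "\<tau> constant_on U"
    obtain p where p: "p \<in> U" using U(2) by blast
    then obtain c0 where c0: "c0 \<in> atlas M" "p \<in> cdom c0"
      using struct U_sub unfolding smooth_structure_def by blast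
    define c where "c = restrict_chart U c0"
    have c: "c \<in> atlas M" "cdom c \<subseteq> U" "p \<in> cdom c"
      using smooth_structure_restrict[OF struct c0(1) U(1)] c0 p by (auto simp: c_def)
    from const obtain k where k: "\<And>q. q \<in> U \<Longrightarrow> \<tau> q = k" unfolding constant_on_def by blast
    have "open (cimage c)" using struct c(1) by (simp add: smooth_structure_def is_chart_def)
    then have "pd i (local_rep c \<tau>) (coord c p) = pd i (\<lambda>y. k) (coord c p)" for i
      by (rule pd_cong) (use c k inv[OF c(1)] in \<open>auto simp: local_rep_def\<close>)
    then have "diff_at \<tau> c p = 0"
      by (simp add: diff_at_def differential_def pd_const vec_eq_iff)
    then show False using nonzero p c by (auto simp: charts_at_def)
  qed
  moreover have "smooth_fun (open_submanifold M U) \<tau>"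
    using smooth(1) by (simp add: smooth_fun_def)
  moreover have "real_holomorphic_gradient (open_submanifold M U) \<tau>"
    unfolding real_holomorphic_gradient_def using main by simp
  moreover have "topspace (mtop (open_submanifold M U)) = U" using U_sub by auto
  ultimately show ?thesis
    unfolding special_kr_potential_def Let_def
    using kahler_manifold_open_submanifold[OF kahler U] main
    by (simp add: charts_at_def metric_at_def cplx_at_def grad_at_def hess_at_def ricci_at_def)
qed

end
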